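(* Let $\Gamma\subset\mathrm{SL}(2,\mathbb{Z})$ be a subgroup of finite index, $k,\lambda\in\mathbb{C}$, and $v:\Gamma\to\mathbb{C}\setminus\{0\}$ a multiplier system compatible with weight $k$. Let $\mathrm{E}^{\pm}_k=\pm 2iy\,\partial_x+2y\,\partial_y\pm k$. Then $\mathrm{E}^{\pm}_k$ maps generalized Maass wave forms of weight $k$ to generalized Maass wave forms of weight $k\pm2$: $$\mathrm{E}^{\pm}_k:\ gM(\Gamma,k,v,\lambda)\to gM(\Gamma,k\pm2,v,\lambda).$$
   Context: $\mathbb{H}=\{z=x+iy\in\mathbb{C}: y>0\}$, on which $\mathrm{SL}(2,\mathbb{R})$ acts by fractional linear transformations. Arguments are normalized by $\arg(w)\in(-\pi,\pi]$ for $w\neq 0$. For $k\in\mathbb{C}$, $\gamma=\begin{pmatrix}a&b\\c&d\end{pmatrix}\in\mathrm{SL}(2,\mathbb{R})$ and $f:\mathbb{H}\to\mathbb{C}$, put $(f|_k\gamma)(z)=e^{-ik\arg(cz+d)}f(\gamma z)$. A multiplier (system) $v$ on $\Gamma$ compatible with weight $k\in\mathbb{C}$ is a function $v:\Gamma\to\mathbb{C}\setminus\{0\}$ such that $f(\gamma z)=v(\gamma)e^{ik\arg(cz+d)}f(z)$ (for all $\gamma=\begin{pmatrix}a&b\\c&d\end{pmatrix}\in\Gamma$, $z\in\mathbb{H}$) allows non-zero solutions $f$. It is not required to be unitary. $\mathcal{C}_\Gamma$ denotes a (finite) set of representatives of the inequivalent cusps of $\Gamma$. For each $q\in\mathcal{C}_\Gamma$,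 the stabilizer of $q$ is $\langle\gamma_q,-\mathbf{1}\rangle$, and $g_q\in\mathrm{SL}(2,\mathbb{Z})$ is a scaling matrix: $q=g_q\,i\infty$ and $g_q^{-1}\gamma_qg_q=\begin{pmatrix}1&l_q\\0&1\end{pmatrix}$, where the positive integer $l_q$ is the width of $q$. Laplace operator: $\Delta_k=-y^2(\partial_x^2+\partial_y^2)+iky\,\partial_x$. $gM(\Gamma,k,v,\lambda)$ denotes the space of generalized Maass wave forms of weight $k$, multiplier $v$ and eigenvalue $\lambda$ for $\Gamma$, i.e. of real-analytic functions $u:\mathbb{H}\to\mathbb{C}$ with (1) $u|_k\gamma=v(\gamma)u$ for all $\gamma\in\Gamma$; (2) $\Delta_ku=\lambda u$; (3) at each cusp $q\in\mathcal{C}_\Gamma$, $u(g_qz)=O(e^{cy})$ as $y\to\infty$ for some $c\in\mathbb{R}$. *)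

theory Defs
  imports "HOL-Analysis.Analysis" "HOL-Algebra.Algebra" "HOL-Library.Landau_Symbols"
begin

definition upper_half_plane :: "complex set" ("\<H>")
  where "\<H> = {z. 0 < Im z}"

definition SL2Z :: "(int^2^2) monoid"
  where "SL2Z = \<lparr>carrier = {A. det A = 1}, mult = (**), one = mat 1\<rparr>"

lemma group_SL2Z: "group SL2Z"
proof (rule groupI)
  fix A assume A: "A \<in> carrier SL2Z"
  define B :: "int^2^2" where "B = vector [vector [A$2$2, - A$1$2], vector [- A$2$1, A$1$1]]"
  have "det B = 1" "B ** A = mat 1"
    using A by (auto simp: SL2Z_def B_def det_2 vector_2 vec_eq_iff forall_2 matrix_matrix_mult_def
      sum_2 mat_def algebra_simps)
  then show "\<exists>B\<in>carrier SL2Z. B \<otimes>\<^bsub>SL2Z\<^esub> A = \<one>\<^bsub>SL2Z\<^esub>"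
    by (auto simp: SL2Z_def)
qed (auto simp: SL2Z_def det_mul matrix_mul_assoc)

definition moebius :: "int^2^2 \<Rightarrow> complex \<Rightarrow> complex"
  where "moebius \<gamma> z =
    (of_int (\<gamma>$1$1) * z + of_int (\<gamma>$1$2)) / (of_int (\<gamma>$2$1) * z + of_int (\<gamma>$2$2))"

text \<open>The argument of \<open>c z + d\<close>; the library function \<^const>\<open>Arg\<close> takes values in \<open>(-\<pi>, \<pi>]\<close>.\<close>

definition arg_factor :: "int^2^2 \<Rightarrow> complex \<Rightarrow> real"
  where "arg_factor \<gamma> z = Arg (of_int (\<gamma>$2$1) * z + of_int (\<gamma>$2$2))"

definition slash :: "(complex \<Rightarrow> complex) \<Rightarrow> complex \<Rightarrow> int^2^2 \<Rightarrow> complex \<Rightarrow> complex"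
  where "slash f k \<gamma> z = exp (- (\<i> * k * of_real (arg_factor \<gamma> z))) * f (moebius \<gamma> z)"

text \<open>Functions on \<open>\<H>\<close> are represented by functions on \<^typ>\<open>complex\<close>
  whose values outside \<open>\<H>\<close> are irrelevant.\<close>

definition multiplier_system :: "(int^2^2) set \<Rightarrow> complex \<Rightarrow> (int^2^2 \<Rightarrow> complex) \<Rightarrow> bool"
  where "multiplier_system \<Gamma> k v \<longleftrightarrow>
    (\<forall>\<gamma>\<in>\<Gamma>. v \<gamma> \<noteq> 0) \<and>
    (\<exists>f :: complex \<Rightarrow> complex.
       (\<forall>\<gamma>\<in>\<Gamma>. \<forall>z\<in>\<H>. f (moebius \<gamma> z) = v \<gamma> * exp (\<i> * k * of_real (arg_factor \<gamma> z)) * f z) \<and>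
       (\<exists>z\<in>\<H>. f z \<noteq> 0))"

text \<open>The cusps of a finite index subgroup of \<open>SL(2,\<int>)\<close> are the points of
  \<open>\<rat> \<union> {i\<infinity>}\<close>; \<^const>\<open>None\<close> stands for \<open>i\<infinity>\<close>.\<close>

type_synonym cusp = "rat option"

fun cusp_act :: "int^2^2 \<Rightarrow> cusp \<Rightarrow> cusp"
  where
    "cusp_act \<gamma> None =
      (if \<gamma>$2$1 = 0 then None else Some (of_int (\<gamma>$1$1) / of_int (\<gamma>$2$1)))"
  | "cusp_act \<gamma> (Some r) =
      (if of_int (\<gamma>$2$1) * r + of_int (\<gamma>$2$2) = 0 then None
       else Some ((of_int (\<gamma>$1$1) * r + of_int (\<gamma>$1$2)) / (of_int (\<gamma>$2$1) * r + of_int (\<gamma>$2$2))))"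

definition cusp_representatives :: "(int^2^2) set \<Rightarrow> cusp set \<Rightarrow> bool"
  where "cusp_representatives \<Gamma> C \<longleftrightarrow>
    finite C \<and> (\<forall>q. \<exists>!p. p \<in> C \<and> (\<exists>\<gamma>\<in>\<Gamma>. cusp_act \<gamma> p = q))"

text \<open>The stabilizer is taken in \<open>\<Gamma> \<union> -\<Gamma>\<close>, which is \<open>\<Gamma>\<close> itself if \<open>-1 \<in> \<Gamma>\<close>. Otherwise
  \<open>-1\<close> could not belong to the stabilizer in \<open>\<Gamma>\<close>.\<close>

definition cusp_stabilizer :: "(int^2^2) set \<Rightarrow> cusp \<Rightarrow> (int^2^2) set"
  where "cusp_stabilizer \<Gamma> q = {\<gamma>. (\<gamma> \<in> \<Gamma> \<or> - \<gamma> \<in> \<Gamma>) \<and> cusp_act \<gamma> q = q}"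

definition scaling_matrix :: "(int^2^2) set \<Rightarrow> cusp \<Rightarrow> int^2^2 \<Rightarrow> bool"
  where "scaling_matrix \<Gamma> q g \<longleftrightarrow>
    g \<in> carrier SL2Z \<and> cusp_act g None = q \<and>
    (\<exists>\<gamma> (l::int). cusp_stabilizer \<Gamma> q = generate SL2Z {\<gamma>, - mat 1} \<and> 0 < l \<and>
       inv\<^bsub>SL2Z\<^esub> g ** \<gamma> ** g = vector [vector [1, l], vector [0, 1]])"

definition dx :: "(complex \<Rightarrow> complex) \<Rightarrow> complex \<Rightarrow> complex"
  where "dx f z = vector_derivative (\<lambda>t. f (Complex t (Im z))) (at (Re z))"

definition dy :: "(complex \<Rightarrow> complex) \<Rightarrow> complex \<Rightarrow> complex"
  where "dy f z = vector_derivative (\<lambda>t. f (Complex (Re z) t)) (at (Im z))"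

definition laplace :: "complex \<Rightarrow> (complex \<Rightarrow> complex) \<Rightarrow> complex \<Rightarrow> complex"
  where "laplace k u z =
    - of_real ((Im z)\<^sup>2) * (dx (dx u) z + dy (dy u) z) + \<i> * k * of_real (Im z) * dx u z"

definition E_plus :: "complex \<Rightarrow> (complex \<Rightarrow> complex) \<Rightarrow> complex \<Rightarrow> complex"
  where "E_plus k u z =
    2 * \<i> * of_real (Im z) * dx u z + 2 * of_real (Im z) * dy u z + k * u z"

definition E_minus :: "complex \<Rightarrow> (complex \<Rightarrow> complex) \<Rightarrow> complex \<Rightarrow> complex"
  where "E_minus k u z =
    - 2 * \<i> * of_real (Im z) * dx u z + 2 * of_real (Im z) * dy u z - k * u z"

text \<open>Real-analyticity in the two real variables \<open>x\<close> and \<open>y\<close>: locally the sum of a double power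
  series (\<^const>\<open>has_sum\<close> is unconditional, hence absolute, convergence).\<close>

definition real_analytic_on :: "(complex \<Rightarrow> complex) \<Rightarrow> complex set \<Rightarrow> bool"
  where "real_analytic_on f S \<longleftrightarrow>
    (\<forall>w\<in>S. \<exists>(a :: nat \<Rightarrow> nat \<Rightarrow> complex) r. 0 < r \<and>
       (\<forall>s t. \<bar>s\<bar> < r \<and> \<bar>t\<bar> < r \<longrightarrow>
          ((\<lambda>(m, n). a m n * of_real s ^ m * of_real t ^ n) has_sum f (w + Complex s t)) UNIV))"

text \<open>Growth \<open>u (g z) = O(e\<^sup>c\<^sup>y)\<close> as \<open>y \<rightarrow> \<infinity>\<close>, uniformly for \<open>x\<close> in bounded intervals. Uniformity in
  all real \<open>x\<close> cannot be asked for, since a non-unitary multiplier permits exponential growth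
  in \<open>x\<close>.\<close>

definition exp_growth :: "(complex \<Rightarrow> complex) \<Rightarrow> int^2^2 \<Rightarrow> bool"
  where "exp_growth u g \<longleftrightarrow>
    (\<exists>c::real. \<forall>a b. (\<lambda>z. u (moebius g z)) \<in>
       O[inf (filtercomap Im at_top) (principal {z. a \<le> Re z \<and> Re z \<le> b})](\<lambda>z.
         of_real (exp (c * Im z))))"

definition gM :: "(int^2^2) set \<Rightarrow> cusp set \<Rightarrow> (cusp \<Rightarrow> int^2^2) \<Rightarrow>
    complex \<Rightarrow> (int^2^2 \<Rightarrow> complex) \<Rightarrow> complex \<Rightarrow> (complex \<Rightarrow> complex) set"
  where "gM \<Gamma> C g k v \<mu> = {u.
    real_analytic_on u \<H> \<and>
    (\<forall>\<gamma>\<in>\<Gamma>. \<forall>z\<in>\<H>. slash u k \<gamma> z = v \<gamma> * u z) \<and>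
    (\<forall>z\<in>\<H>. laplace k u z = \<mu> * u z) \<and>
    (\<forall>q\<in>C. exp_growth u (g q))}"

end

theory Submission
  imports Defs
begin

text \<open>
  Let \<open>E\<close> be one of the two operators and \<open>\<sigma> = \<plusminus>1\<close> its sign, so that \<open>E\<close> shifts the weight from \<open>k\<close> to
  \<open>k + 2\<sigma>\<close>. Each of the four conditions that define a generalized Maass wave form passes from \<open>u\<close>
  to \<open>E u\<close> for its own reason.

  Real-analyticity: a double power series may be differentiated term by term
  (\<open>double_power_series_dx\<close>), so the real-analytic functions are closed under everything that \<open>E\<close>
  is made of.

  Transformation law: \<open>E\<close> intertwines the slash actions of weight \<open>k\<close> and \<open>k + 2\<sigma>\<close>
  (\<open>maass_op_slash\<close>). By the chain rule this comes down to the two identities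
  \<open>e\<^sup>-\<^sup>2\<^sup>i\<^sup>\<theta> = cnj j / j\<close> for \<open>j = c z + d\<close> with argument \<open>\<theta>\<close>, and \<open>j - cnj j = 2 i c y\<close>.

  Eigenvalue equation: raising and then lowering is \<open>-4 \<Delta>\<^sub>k\<close> plus a constant that depends on \<open>k\<close>
  (\<open>maass_op_maass_op\<close>); lowering and then raising is the same up to the constant. Associativity
  of \<open>E\<^sup>+ E\<^sup>- E\<^sup>+\<close> then yields \<open>\<Delta> E = E \<Delta>\<close> with the appropriate weights (\<open>laplace_maass_op\<close>).

  Growth: this condition is the hard one, because it bounds \<open>u\<close> but not its
  derivatives. The remedy is elliptic regularity. At a cusp replace \<open>u\<close> by \<open>w = u|\<^sub>k g\<close>, which
  satisfies the same equation, and which has the same growth up to constants since the factor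
  \<open>e\<^sup>-\<^sup>i\<^sup>k\<^sup>\<theta>\<close> is bounded above and below. Written as
  \<open>w\<^sub>x\<^sub>x + w\<^sub>y\<^sub>y = (i k / y) w\<^sub>x - (\<mu> / y\<^sup>2) w\<close>, the equation has coefficients at most \<open>1\<close> in modulus as
  soon as \<open>y\<close> is large, so the gradient of \<open>w\<close> at \<open>z\<close> is bounded by a fixed multiple of the maximum of \<open>|w|\<close>
  on the square \<open>square z 1\<close> (\<open>interior_gradient_estimate\<close>). This costs only a
  constant factor in \<open>O(e\<^sup>c\<^sup>y)\<close>, and the factor \<open>y\<close> in \<open>E\<close> is absorbed by replacing \<open>c\<close> with \<open>c + 1\<close>.
  The gradient bound itself follows from the minimum principle for superharmonic functions on a
  rectangle (\<open>superharmonic_nonneg\<close>) and an explicit quadratic barrier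
  (\<open>gradient_estimate_poisson_real\<close>).
\<close>

section \<open>Partial derivatives of real-analytic functions\<close>

definition double_power_series ::
    "(complex \<Rightarrow> complex) \<Rightarrow> complex \<Rightarrow> (nat \<Rightarrow> nat \<Rightarrow> complex) \<Rightarrow> real \<Rightarrow> bool"
  where "double_power_series f w a r \<longleftrightarrow> 0 < r \<and>
    (\<forall>s t. \<bar>s\<bar> < r \<and> \<bar>t\<bar> < r \<longrightarrow>
       ((\<lambda>(m, n). a m n * of_real s ^ m * of_real t ^ n) has_sum f (w + Complex s t)) UNIV)"

lemma real_analytic_on_iff_double_power_series:
  "real_analytic_on f S \<longleftrightarrow> (\<forall>w\<in>S. \<exists>a r. double_power_series f w a r)"
  by (simp add: real_analytic_on_def double_power_series_def)

lemma double_power_series_has_sum: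
  assumes "double_power_series f w a r" "\<bar>s\<bar> < r" "\<bar>t\<bar> < r"
  shows "((\<lambda>(m, n). a m n * of_real s ^ m * of_real t ^ n) has_sum f (w + Complex s t)) UNIV"
  using assms unfolding double_power_series_def by blast

lemma double_power_series_abs_summable:
  assumes "double_power_series f w a r" "0 \<le> \<rho>" "\<rho> < r"
  shows "(\<lambda>(m, n). norm (a m n) * \<rho> ^ m * \<rho> ^ n) summable_on UNIV"
proof -
  have "(\<lambda>(m, n). a m n * of_real \<rho> ^ m * of_real \<rho> ^ n) summable_on UNIV"
    by (rule has_sum_imp_summable[OF double_power_series_has_sum[OF assms(1)]]) (use assms in auto)
  then have "(\<lambda>x. norm (case x of (m, n) \<Rightarrow> a m n * of_real \<rho> ^ m * of_real \<rho> ^ n)) summable_on UNIV"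
    by (simp add: summable_on_iff_abs_summable_on_complex)
  then show ?thesis
    using assms(2) by (simp add: case_prod_unfold norm_mult norm_power)
qed

text \<open>At its centre a double power series is differentiable because the sum of all terms of degree at
  least two is bounded by a constant times the square of the distance. Since every point of the
  domain of a real-analytic function is the centre of some expansion, no other point of the
  bidisc has to be considered.\<close>

lemma double_power_series_has_derivative:
  assumes ser: "double_power_series f w a r"
  shows "(f has_derivative (\<lambda>h. of_real (Re h) * a 1 0 + of_real (Im h) * a 0 1)) (at w)"
proof -
  have r: "0 < r" using ser by (simp add: double_power_series_def)
  define \<rho> where "\<rho> = r / 2"
  have \<rho>: "0 < \<rho>" "\<rho> < r" using r by (auto simp: \<rho>_def)
  define B where "B = (\<lambda>(m, n). norm (a m n) * \<rho> ^ m * \<rho> ^ n)"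
  have B: "B summable_on UNIV"
    unfolding B_def using double_power_series_abs_summable[OF ser] \<rho> by simp
  define F :: "(nat \<times> nat) set" where "F = {(0,0), (1,0), (0,1)}"
  define K where "K = infsum B (UNIV - F)"
  have BK: "(B has_sum K) (UNIV - F)"
    unfolding K_def by (intro has_sum_infsum summable_on_subset_banach[OF B]) auto
  have zero: "f w = a 0 0"
  proof -
    have "((\<lambda>(m, n). a m n * of_real 0 ^ m * of_real 0 ^ n) has_sum f (w + Complex 0 0)) UNIV"
      by (rule double_power_series_has_sum[OF ser]) (use r in auto)
    moreover have "((\<lambda>(m, n). a m n * of_real 0 ^ m * of_real 0 ^ n) has_sum a 0 0) UNIV"
      using has_sum_finite[of "{(0::nat,0::nat)}" "\<lambda>(m, n). a m n * of_real 0 ^ m * of_real 0 ^ n"]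
      by (subst has_sum_cong_neutral[where T="{(0::nat,0::nat)}"]) auto
    ultimately show ?thesis
      using has_sum_unique by (fastforce simp: Complex_eq)
  qed
  have bound: "norm (f (w + h) - f w - (of_real (Re h) * a 1 0 + of_real (Im h) * a 0 1))
      \<le> K / \<rho>\<^sup>2 * (norm h)\<^sup>2" if h: "norm h < \<rho>" for h
  proof -
    define s t where "s = Re h" and "t = Im h"
    have st: "\<bar>s\<bar> \<le> norm h" "\<bar>t\<bar> \<le> norm h"
      by (auto simp: s_def t_def abs_Re_le_cmod abs_Im_le_cmod)
    let ?T = "\<lambda>(m, n). a m n * of_real s ^ m * of_real t ^ n"
    have "(?T has_sum f (w + Complex s t)) UNIV"
      using ser st h \<rho> unfolding double_power_series_def by auto
    moreover have "(?T has_sum (sum ?T F)) F"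
      by (rule has_sum_finite) (simp add: F_def)
    ultimately have D: "(?T has_sum (f (w + Complex s t) - sum ?T F)) (UNIV - F)"
      by (rule has_sum_Diff) auto
    have "norm (f (w + Complex s t) - sum ?T F) \<le> (norm h / \<rho>)\<^sup>2 * K"
    proof (rule norm_infsum_le[OF D has_sum_cmult_right[OF BK]])
      fix x assume x: "x \<in> UNIV - F"
      obtain m n where mn: "x = (m, n)" by force
      have ge2: "2 \<le> m + n" using x by (cases m; cases n) (auto simp: F_def mn)
      \<comment> \<open>a term of degree at least two gains the factor (norm h / \<rho>)^2
        over its value at the corner (\<rho>, \<rho>)\<close>
      have "\<bar>s\<bar> ^ m * \<bar>t\<bar> ^ n \<le> norm h ^ m * norm h ^ n"
        using st by (intro mult_mono power_mono) auto
      also have "\<dots> = (norm h / \<rho>) ^ (m + n) * (\<rho> ^ m * \<rho> ^ n)"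
        using \<rho> by (simp add: power_add power_divide)
      also have "\<dots> \<le> (norm h / \<rho>)\<^sup>2 * (\<rho> ^ m * \<rho> ^ n)"
        using ge2 h \<rho> by (intro mult_right_mono power_decreasing) (auto simp: divide_simps)
      finally have "norm (a m n) * (\<bar>s\<bar> ^ m * \<bar>t\<bar> ^ n) \<le> norm (a m n) * \<dots>"
        by (rule mult_left_mono) auto
      then show "norm (?T x) \<le> (norm h / \<rho>)\<^sup>2 * B x"
        by (simp add: mn B_def norm_mult norm_power mult_ac)
    qed
    moreover have "sum ?T F = f w + (of_real s * a 1 0 + of_real t * a 0 1)"
      by (simp add: F_def zero mult_ac)
    moreover have "Complex s t = h" by (simp add: s_def t_def)
    ultimately show ?thesis using \<rho> by (simp add: s_def t_def field_simps power_divide power2_eq_square)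
  qed
  show ?thesis
  proof (rule has_derivativeI_sandwich[where e = \<rho> and H = "\<lambda>y. K / \<rho>\<^sup>2 * norm (y - w)"])
    show "bounded_linear (\<lambda>h. of_real (Re h) * a 1 0 + of_real (Im h) * a 0 1)"
      by (intro bounded_linear_add bounded_linear_compose[OF bounded_linear_mult_left]
            bounded_linear_compose[OF bounded_linear_of_real] bounded_linear_Re bounded_linear_Im)
    show "((\<lambda>y. K / \<rho>\<^sup>2 * norm (y - w)) \<longlongrightarrow> 0) (at w)"
      using \<rho> by (auto intro!: tendsto_eq_intros)
  next
    fix y assume y: "y \<noteq> w" "dist y w < \<rho>"
    have "norm (f (w + (y - w)) - f w - (of_real (Re (y - w)) * a 1 0 + of_real (Im (y - w)) * a 0 1))
        \<le> K / \<rho>\<^sup>2 * (norm (y - w))\<^sup>2"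
      by (rule bound) (use y in \<open>simp add: dist_norm\<close>)
    then show "norm (f y - f w - (of_real (Re (y - w)) * a 1 0 + of_real (Im (y - w)) * a 0 1))
        / norm (y - w) \<le> K / \<rho>\<^sup>2 * norm (y - w)"
      using y by (simp add: divide_le_eq power2_eq_square mult.assoc)
  qed (use \<rho> in auto)
qed

lemma has_derivative_imp_dx_dy:
  assumes "(f has_derivative D) (at z)"
  shows "dx f z = D 1" "dy f z = D \<i>"
proof -
  interpret D: bounded_linear D using assms by (rule has_derivative_bounded_linear)
  have "((\<lambda>s. Complex s (Im z)) has_derivative (\<lambda>s. s *\<^sub>R 1)) (at (Re z))"
    unfolding Complex_eq by (auto intro!: derivative_eq_intros simp: scaleR_conv_of_real)
  then have "((\<lambda>s. f (Complex s (Im z))) has_derivative (\<lambda>s. D (s *\<^sub>R 1))) (at (Re z))"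
    by (rule has_derivative_compose) (use assms in simp)
  then have x: "((\<lambda>s. f (Complex s (Im z))) has_vector_derivative D 1) (at (Re z))"
    unfolding has_vector_derivative_def D.scaleR .
  have "((\<lambda>t. Complex (Re z) t) has_derivative (\<lambda>t. t *\<^sub>R \<i>)) (at (Im z))"
    unfolding Complex_eq by (auto intro!: derivative_eq_intros simp: scaleR_conv_of_real)
  then have "((\<lambda>t. f (Complex (Re z) t)) has_derivative (\<lambda>t. D (t *\<^sub>R \<i>))) (at (Im z))"
    by (rule has_derivative_compose) (use assms in simp)
  then have y: "((\<lambda>t. f (Complex (Re z) t)) has_vector_derivative D \<i>) (at (Im z))"
    unfolding has_vector_derivative_def D.scaleR .
  show "dx f z = D 1" using vector_derivative_at[OF x] by (simp add: dx_def)
  show "dy f z = D \<i>" using vector_derivative_at[OF y] by (simp add: dy_def)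
qed

text \<open>For fixed \<open>t\<close> the series is an ordinary power series in \<open>s\<close>, which may be differentiated term by
  term anywhere in its disc of convergence. What remains is that the differentiated family is
  summable over pairs of indices, not only as an iterated sum: for \<open>|s| < \<sigma>\<close> the factor
  \<open>(m + 1) (|s| / \<sigma>)\<^sup>m\<close> is bounded, so the family is dominated by the original one at \<open>(\<sigma>, \<sigma>)\<close>.\<close>

lemma double_power_series_dx:
  assumes ser: "double_power_series f w a r"
  shows "double_power_series (dx f) w (\<lambda>m n. of_nat (Suc m) * a (Suc m) n) r"
  unfolding double_power_series_def
proof (intro conjI allI impI, goal_cases)
  case 1
  show ?case using ser by (simp add: double_power_series_def)
next
  case (2 s t)
  \<comment> \<open>a radius strictly between the given point and the boundary of the bidisc\<close>
  define \<sigma> where "\<sigma> = (max \<bar>s\<bar> \<bar>t\<bar> + r) / 2"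
  have \<sigma>: "\<bar>s\<bar> < \<sigma>" "\<bar>t\<bar> < \<sigma>" "\<sigma> < r" "0 < \<sigma>" using 2 by (auto simp: \<sigma>_def)
  have A: "(\<lambda>(m, n). norm (a m n) * \<sigma> ^ m * \<sigma> ^ n) summable_on UNIV"
    using double_power_series_abs_summable[OF ser] \<sigma> by simp
  define c where "c m = (\<Sum>\<^sub>\<infinity>n. a m n * of_real t ^ n)" for m
  have c: "((\<lambda>n. a m n * of_real t ^ n) has_sum c m) UNIV" for m
  proof -
    have "(\<lambda>(m, n). norm (a m n) * \<sigma> ^ m * \<sigma> ^ n) summable_on range (Pair m)"
      using summable_on_subset_banach[OF A] by blast
    then have "(\<lambda>n. norm (a m n) * \<sigma> ^ m * \<sigma> ^ n) summable_on UNIV"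
      by (subst (asm) summable_on_reindex) (auto simp: inj_on_def o_def)
    then have "(\<lambda>n. inverse (\<sigma> ^ m) * (norm (a m n) * \<sigma> ^ m * \<sigma> ^ n)) summable_on UNIV"
      by (rule summable_on_cmult_right)
    then have "(\<lambda>n. norm (a m n) * \<sigma> ^ n) summable_on UNIV"
      using \<sigma> by (simp add: field_simps)
    then have "(\<lambda>n. norm (a m n * of_real t ^ n)) summable_on UNIV"
      by (rule summable_on_comparison_test)
        (use \<sigma> in \<open>auto simp: norm_mult norm_power intro!: mult_left_mono power_mono\<close>)
    then show ?thesis
      unfolding c_def by (rule has_sum_infsum[OF abs_summable_summable])
  qed
  have f: "((\<lambda>m. c m * of_real s' ^ m) has_sum f (w + Complex s' t)) UNIV" if "\<bar>s'\<bar> < r" for s'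
  proof (rule has_sum_SigmaD[where A = UNIV and B = "\<lambda>_. UNIV"])
    show "((\<lambda>(m, n). a m n * of_real s' ^ m * of_real t ^ n) has_sum f (w + Complex s' t)) (UNIV \<times> UNIV)"
      using ser that 2 unfolding double_power_series_def by simp
    show "((\<lambda>n. case (m, n) of (m, n) \<Rightarrow> a m n * of_real s' ^ m * of_real t ^ n)
        has_sum c m * of_real s' ^ m) UNIV" for m
      using has_sum_cmult_left[OF c, of m "of_real s' ^ m"] by (simp add: mult_ac)
  qed
  have fs: "(\<lambda>m. c m * of_real s' ^ m) sums f (w + Complex s' t)" if "\<bar>s'\<bar> < r" for s'
    using has_sum_imp_sums[OF f[OF that]] .
  define G :: "complex \<Rightarrow> complex" where "G z = suminf (\<lambda>m. c m * z ^ m)" for z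
  have Gf: "G (of_real s') = f (w + Complex s' t)" if "\<bar>s'\<bar> < r" for s'
    using sums_unique[OF fs[OF that]] by (simp add: G_def)
  have "(G has_field_derivative (suminf (\<lambda>m. diffs c m * of_real s ^ m))) (at (of_real s))"
    unfolding G_def
    by (rule termdiffs_strong[where K = "of_real \<sigma>"])
      (use fs[of \<sigma>] \<sigma> in \<open>auto simp: sums_iff\<close>)
  then have "((\<lambda>s'. G (of_real s')) has_vector_derivative (suminf (\<lambda>m. diffs c m * of_real s ^ m))) (at s)"
    by (rule has_vector_derivative_real_field)
  then have "((\<lambda>s'. f (w + Complex s' t)) has_vector_derivative (suminf (\<lambda>m. diffs c m * of_real s ^ m))) (at s)"
    by (rule has_vector_derivative_transform_within_open[where S = "{-r<..<r}"])
      (use 2 Gf in auto)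
  then have "((\<lambda>s'. f (w + Complex (s' - Re w) t)) has_vector_derivative
      (suminf (\<lambda>m. diffs c m * of_real s ^ m))) (at (Re w + s))"
    using vector_diff_chain_at[of "\<lambda>s'. s' - Re w" 1 "Re w + s" "\<lambda>s'. f (w + Complex s' t)"]
    by (simp add: o_def has_vector_derivative_diff_const)
  moreover have "w + Complex (s' - Re w) t = Complex s' (Im (w + Complex s t))" for s'
    by (simp add: complex_eq_iff)
  ultimately have dxf: "dx f (w + Complex s t) = suminf (\<lambda>m. diffs c m * of_real s ^ m)"
    unfolding dx_def by (intro vector_derivative_at) simp
  define T where "T = (\<lambda>(m, n). of_nat (Suc m) * a (Suc m) n * of_real s ^ m * of_real t ^ n)"
  define q where "q = \<bar>s\<bar> / \<sigma>"
  have q: "0 \<le> q" "q < 1" using \<sigma> by (auto simp: q_def)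
  have "Bseq (\<lambda>m. of_nat m * q ^ m + q ^ m)"
    using q by (intro convergent_imp_Bseq convergentI[of _ "0 + 0"] tendsto_add
      powser_times_n_limit_0 LIMSEQ_realpow_zero) auto
  then obtain M where M: "\<And>m. norm (of_nat m * q ^ m + q ^ m) \<le> M" unfolding Bseq_def by blast
  have "(\<lambda>(m, n). norm (a m n) * \<sigma> ^ m * \<sigma> ^ n) summable_on (range (map_prod Suc id))"
    using summable_on_subset_banach[OF A] by blast
  then have "(\<lambda>(m, n). norm (a (Suc m) n) * \<sigma> ^ Suc m * \<sigma> ^ n) summable_on UNIV"
    by (subst (asm) summable_on_reindex) (auto simp: inj_on_def o_def case_prod_unfold)
  then have "(\<lambda>x. M / \<sigma> * (case x of (m, n) \<Rightarrow> norm (a (Suc m) n) * \<sigma> ^ Suc m * \<sigma> ^ n)) summable_on UNIV"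
    by (rule summable_on_cmult_right)
  then have "(\<lambda>x. norm (T x)) summable_on UNIV"
  proof (rule summable_on_comparison_test)
    fix x :: "nat \<times> nat"
    obtain m n where x: "x = (m, n)" by force
    have "real (Suc m) * \<bar>s\<bar> ^ m = (of_nat m * q ^ m + q ^ m) * \<sigma> ^ m"
      using \<sigma> by (simp add: q_def power_divide field_simps)
    also have "\<dots> \<le> M * \<sigma> ^ m"
      using M[of m] \<sigma> by (intro mult_right_mono) auto
    finally have Mm: "real (Suc m) * \<bar>s\<bar> ^ m \<le> M * \<sigma> ^ m" .
    moreover have "0 \<le> real (Suc m) * \<bar>s\<bar> ^ m" by simp
    ultimately have "0 \<le> M * \<sigma> ^ m" by linarith
    then have "real (Suc m) * \<bar>s\<bar> ^ m * \<bar>t\<bar> ^ n \<le> M * \<sigma> ^ m * \<sigma> ^ n"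
      using \<sigma> by (intro mult_mono[OF Mm power_mono]) auto
    then have "norm (a (Suc m) n) * (real (Suc m) * \<bar>s\<bar> ^ m * \<bar>t\<bar> ^ n)
        \<le> norm (a (Suc m) n) * (M * \<sigma> ^ m * \<sigma> ^ n)"
      by (rule mult_left_mono) auto
    then show "norm (T x) \<le> M / \<sigma> * (case x of (m, n) \<Rightarrow> norm (a (Suc m) n) * \<sigma> ^ Suc m * \<sigma> ^ n)"
      using \<sigma> by (simp add: x T_def norm_mult norm_power mult_ac del: of_nat_Suc)
  qed auto
  then have T: "(T has_sum infsum T UNIV) (UNIV \<times> UNIV)"
    by (simp add: abs_summable_summable)
  have "((\<lambda>m. diffs c m * of_real s ^ m) has_sum infsum T UNIV) UNIV"
  proof (rule has_sum_SigmaD[OF T])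
    show "((\<lambda>n. T (m, n)) has_sum diffs c m * of_real s ^ m) UNIV" for m
      using has_sum_cmult_left[OF c, of "Suc m" "of_nat (Suc m) * of_real s ^ m"]
      by (simp add: T_def diffs_def mult_ac del: of_nat_Suc)
  qed
  from sums_unique[OF has_sum_imp_sums[OF this]] have "infsum T UNIV = dx f (w + Complex s t)"
    by (simp only: dxf)
  then show ?case using T by (simp add: T_def)
qed

text \<open>Exchanging the two real coordinates turns \<open>dy\<close> into \<open>dx\<close>.\<close>

lemma double_power_series_transpose:
  assumes "double_power_series f w a r"
  shows "double_power_series (\<lambda>z. f (Complex (Im z) (Re z))) (Complex (Im w) (Re w)) (\<lambda>m n. a n m) r"
  unfolding double_power_series_def
proof (intro conjI allI impI, goal_cases)
  case 1
  show ?case using assms by (simp add: double_power_series_def)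
next
  case (2 s t)
  then have "((\<lambda>(m, n). a m n * of_real t ^ m * of_real s ^ n) has_sum f (w + Complex t s)) UNIV"
    using assms by (auto simp: double_power_series_def)
  moreover have "bij_betw prod.swap (UNIV :: (nat \<times> nat) set) UNIV"
    by (simp add: bij_betw_def)
  ultimately have "((\<lambda>x. (case prod.swap x of (m, n) \<Rightarrow> a m n * of_real t ^ m * of_real s ^ n))
      has_sum f (w + Complex t s)) UNIV"
    by (subst has_sum_reindex_bij_betw) auto
  moreover have "Complex (Im (Complex (Im w) (Re w) + Complex s t)) (Re (Complex (Im w) (Re w) + Complex s t))
      = w + Complex t s"
    by (simp add: complex_eq_iff)
  ultimately show ?case by (simp add: case_prod_unfold mult_ac)
qed

lemma double_power_series_dy:
  assumes "double_power_series f w a r"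
  shows "double_power_series (dy f) w (\<lambda>m n. of_nat (Suc n) * a m (Suc n)) r"
proof -
  have "dy f = (\<lambda>z. dx (\<lambda>z. f (Complex (Im z) (Re z))) (Complex (Im z) (Re z)))"
    by (simp add: fun_eq_iff dx_def dy_def)
  then show ?thesis
    using double_power_series_transpose[OF double_power_series_dx[OF double_power_series_transpose[OF assms]]]
    by simp
qed

text \<open>Multiplication by \<open>Im z = Im w + t\<close> is a constant multiple plus a shift of the second index.\<close>

lemma double_power_series_mult_Im:
  assumes "double_power_series f w a r"
  shows "double_power_series (\<lambda>z. of_real (Im z) * f z) w
    (\<lambda>m n. of_real (Im w) * a m n + (if n = 0 then 0 else a m (n - 1))) r"
  unfolding double_power_series_def
proof (intro conjI allI impI, goal_cases)
  case 1
  show ?case using assms by (simp add: double_power_series_def)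
next
  case (2 s t)
  define T where "T = (\<lambda>(m, n). a m n * of_real s ^ m * of_real t ^ n)"
  define T' where "T' = (\<lambda>(m, n). (if n = 0 then 0 else a m (n - 1)) * of_real s ^ m * of_real t ^ n)"
  have T: "(T has_sum f (w + Complex s t)) UNIV"
    using assms 2 unfolding T_def by (auto simp: double_power_series_def)
  have "T' \<circ> map_prod id Suc = (\<lambda>x. of_real t * T x)"
    by (auto simp: T'_def T_def fun_eq_iff)
  then have "(T' has_sum of_real t * f (w + Complex s t)) (range (map_prod id Suc))"
    using has_sum_cmult_right[OF T] by (subst has_sum_reindex) (auto simp: inj_on_def)
  moreover have "(T' has_sum x) (range (map_prod id Suc)) \<longleftrightarrow> (T' has_sum x) UNIV" for x
  proof (rule has_sum_cong_neutral)
    fix x :: "nat \<times> nat" assume x: "x \<in> UNIV - range (map_prod id Suc)"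
    obtain m n where [simp]: "x = (m, n)" by force
    have "n = 0"
    proof (cases n)
      case (Suc n')
      then have "x = map_prod id Suc (m, n')" by simp
      then show ?thesis using x by blast
    qed
    then show "T' x = 0" by (simp add: T'_def)
  qed auto
  ultimately have "((\<lambda>x. of_real (Im w) * T x + T' x) has_sum
      of_real (Im w) * f (w + Complex s t) + of_real t * f (w + Complex s t)) UNIV"
    by (intro has_sum_add has_sum_cmult_right T) auto
  moreover have "(\<lambda>x. of_real (Im w) * T x + T' x) = (\<lambda>(m, n).
      (of_real (Im w) * a m n + (if n = 0 then 0 else a m (n - 1))) * of_real s ^ m * of_real t ^ n)"
    by (auto simp: T_def T'_def fun_eq_iff algebra_simps)
  ultimately show ?case by (simp add: algebra_simps)
qed

lemma double_power_series_cmult: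
  assumes "double_power_series f w a r"
  shows "double_power_series (\<lambda>z. c * f z) w (\<lambda>m n. c * a m n) r"
  unfolding double_power_series_def
proof (intro conjI allI impI, goal_cases)
  case 1
  show ?case using assms by (simp add: double_power_series_def)
next
  case (2 s t)
  then have "((\<lambda>(m, n). a m n * of_real s ^ m * of_real t ^ n) has_sum f (w + Complex s t)) UNIV"
    using assms by (auto simp: double_power_series_def)
  from has_sum_cmult_right[OF this, of c] show ?case
    by (simp add: case_prod_unfold mult_ac)
qed

lemma double_power_series_add:
  assumes "double_power_series f w a r" "double_power_series g w b r'"
  shows "double_power_series (\<lambda>z. f z + g z) w (\<lambda>m n. a m n + b m n) (min r r')"
  unfolding double_power_series_def
proof (intro conjI allI impI, goal_cases)
  case 1
  show ?case using assms by (simp add: double_power_series_def)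
next
  case (2 s t)
  then have "((\<lambda>(m, n). a m n * of_real s ^ m * of_real t ^ n) has_sum f (w + Complex s t)) UNIV"
    and "((\<lambda>(m, n). b m n * of_real s ^ m * of_real t ^ n) has_sum g (w + Complex s t)) UNIV"
    using assms by (auto simp: double_power_series_def)
  from has_sum_add[OF this] show ?case
    by (simp add: case_prod_unfold algebra_simps)
qed

lemma real_analytic_on_dx: "real_analytic_on f S \<Longrightarrow> real_analytic_on (dx f) S"
  unfolding real_analytic_on_iff_double_power_series using double_power_series_dx by blast

lemma real_analytic_on_dy: "real_analytic_on f S \<Longrightarrow> real_analytic_on (dy f) S"
  unfolding real_analytic_on_iff_double_power_series using double_power_series_dy by blast

lemma real_analytic_on_mult_Im:
  "real_analytic_on f S \<Longrightarrow> real_analytic_on (\<lambda>z. of_real (Im z) * f z) S"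
  unfolding real_analytic_on_iff_double_power_series using double_power_series_mult_Im by blast

lemma real_analytic_on_cmult: "real_analytic_on f S \<Longrightarrow> real_analytic_on (\<lambda>z. c * f z) S"
  unfolding real_analytic_on_iff_double_power_series using double_power_series_cmult by blast

lemma real_analytic_on_add:
  "real_analytic_on f S \<Longrightarrow> real_analytic_on g S \<Longrightarrow> real_analytic_on (\<lambda>z. f z + g z) S"
  unfolding real_analytic_on_iff_double_power_series using double_power_series_add by blast

lemma real_analytic_on_imp_differentiable:
  "real_analytic_on f S \<Longrightarrow> z \<in> S \<Longrightarrow> f differentiable (at z)"
  unfolding real_analytic_on_iff_double_power_series differentiable_def
  using double_power_series_has_derivative by blast

text \<open>Both mixed derivatives at the centre are the coefficient of \<open>s t\<close>.\<close>

lemma real_analytic_on_imp_mixed_partials_eq: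
  assumes "real_analytic_on f S" "z \<in> S"
  shows "dx (dy f) z = dy (dx f) z"
proof -
  obtain a r where "double_power_series f z a r"
    using assms unfolding real_analytic_on_iff_double_power_series by blast
  note ser = double_power_series_has_derivative[OF double_power_series_dx[OF this]]
    double_power_series_has_derivative[OF double_power_series_dy[OF this]]
  show ?thesis
    using has_derivative_imp_dx_dy(2)[OF ser(1)] has_derivative_imp_dx_dy(1)[OF ser(2)] by simp
qed

section \<open>The minimum principle and a barrier\<close>

lemma second_derivative_nonneg_at_local_min:
  fixes h h' :: "real \<Rightarrow> real"
  assumes "0 < d"
    and h: "\<And>s. \<bar>s - x\<bar> < d \<Longrightarrow> (h has_real_derivative h' s) (at s)"
    and h': "(h' has_real_derivative l) (at x)"
    and min: "\<And>s. \<bar>s - x\<bar> < d \<Longrightarrow> h x \<le> h s"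
  shows "0 \<le> l"
proof (rule ccontr)
  assume "\<not> 0 \<le> l"
  then obtain e where e: "0 < e" "\<And>s. 0 < s \<Longrightarrow> s < e \<Longrightarrow> h' (x + s) < h' x"
    using DERIV_neg_dec_right[OF h'] by auto
  have "h' x = 0"
    using DERIV_local_min[OF h[of x], of d] assms(1) min by (simp add: abs_minus_commute)
  define b where "b = x + min d e / 2"
  have b: "x < b" "b - x < d" "b - x < e" using assms(1) e(1) by (auto simp: b_def)
  have "h b < h x"
  proof (rule DERIV_neg_imp_decreasing_open[OF b(1)])
    fix s assume s: "x < s" "s < b"
    then have "h' s < 0" using e(2)[of "s - x"] b \<open>h' x = 0\<close> by simp
    then show "\<exists>y. (h has_real_derivative y) (at s) \<and> y < 0"
      using h[of s] s b by auto
  next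
    show "continuous_on {x..b} h"
      by (intro continuous_at_imp_continuous_on ballI DERIV_isCont[OF h]) (use b in auto)
  qed
  then show False using min[of b] b by simp
qed

text \<open>The weak minimum principle: at an interior minimum both second partial derivatives would be
  nonnegative, against the strict sign of their sum. So the minimum lies on the boundary.\<close>

lemma superharmonic_nonneg:
  fixes V V1 V2 V11 V22 :: "real \<Rightarrow> real \<Rightarrow> real"
  assumes cont: "continuous_on ({a..b} \<times> {c..d}) (\<lambda>(s, t). V s t)"
    and V1: "\<And>s t. a < s \<Longrightarrow> s < b \<Longrightarrow> c < t \<Longrightarrow> t < d \<Longrightarrow>
      ((\<lambda>s. V s t) has_real_derivative V1 s t) (at s)"
    and V11: "\<And>s t. a < s \<Longrightarrow> s < b \<Longrightarrow> c < t \<Longrightarrow> t < d \<Longrightarrow>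
      ((\<lambda>s. V1 s t) has_real_derivative V11 s t) (at s)"
    and V2: "\<And>s t. a < s \<Longrightarrow> s < b \<Longrightarrow> c < t \<Longrightarrow> t < d \<Longrightarrow>
      ((\<lambda>t. V s t) has_real_derivative V2 s t) (at t)"
    and V22: "\<And>s t. a < s \<Longrightarrow> s < b \<Longrightarrow> c < t \<Longrightarrow> t < d \<Longrightarrow>
      ((\<lambda>t. V2 s t) has_real_derivative V22 s t) (at t)"
    and neg: "\<And>s t. a < s \<Longrightarrow> s < b \<Longrightarrow> c < t \<Longrightarrow> t < d \<Longrightarrow> V11 s t + V22 s t < 0"
    and bd: "\<And>s t. s \<in> {a..b} \<Longrightarrow> t \<in> {c..d} \<Longrightarrow> s = a \<or> s = b \<or> t = c \<or> t = d \<Longrightarrow> 0 \<le> V s t"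
    and "s \<in> {a..b}" "t \<in> {c..d}"
  shows "0 \<le> V s t"
proof -
  have "\<exists>p\<in>{a..b} \<times> {c..d}. \<forall>q\<in>{a..b} \<times> {c..d}. (\<lambda>(s, t). V s t) p \<le> (\<lambda>(s, t). V s t) q"
    by (rule continuous_attains_inf) (use cont assms(8,9) in \<open>auto intro: compact_Times\<close>)
  then obtain s0 t0 where 0: "s0 \<in> {a..b}" "t0 \<in> {c..d}"
    and min: "\<And>s t. s \<in> {a..b} \<Longrightarrow> t \<in> {c..d} \<Longrightarrow> V s0 t0 \<le> V s t"
    by auto
  have "0 \<le> V s0 t0"
  proof (cases "s0 = a \<or> s0 = b \<or> t0 = c \<or> t0 = d")
    case False
    then have i: "a < s0" "s0 < b" "c < t0" "t0 < d" using 0 by auto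
    define e where "e = Min {s0 - a, b - s0, t0 - c, d - t0}"
    have e: "0 < e" "e \<le> s0 - a" "e \<le> b - s0" "e \<le> t0 - c" "e \<le> d - t0"
      using i by (auto simp: e_def)
    have "0 \<le> V11 s0 t0"
      by (rule second_derivative_nonneg_at_local_min[OF e(1), where x = s0
            and h = "\<lambda>s. V s t0" and h' = "\<lambda>s. V1 s t0"])
        (use e i in \<open>auto intro!: V1 V11 min\<close>)
    moreover have "0 \<le> V22 s0 t0"
      by (rule second_derivative_nonneg_at_local_min[OF e(1), where x = t0
            and h = "\<lambda>t. V s0 t" and h' = "\<lambda>t. V2 s0 t"])
        (use e i in \<open>auto intro!: V2 V22 min\<close>)
    ultimately show ?thesis using neg[OF i] by simp
  qed (use bd 0 in blast)
  then show ?thesis using min assms(8,9) by force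
qed

text \<open>The bound for the normal derivative in the middle of a square, for a function \<open>U\<close> with \<open>|U| \<le> M\<close>
  and \<open>|\<Delta> U| \<le> N\<close>. The odd part \<open>\<phi>(s, t) = (U(s, t) - U(-s, t)) / 2\<close> vanishes on the line \<open>s = 0\<close> and
  has the same \<open>s\<close>-derivative as \<open>U\<close> at the centre. On the half square \<open>s \<ge> 0\<close> it lies below the barrier
  \<open>\<psi>(s, t) = M / \<rho>\<^sup>2 (t\<^sup>2 + s (2\<rho> - s)) + N / 2 s (\<rho> - s)\<close>: the first summand of \<open>\<psi>\<close> is harmonic, nonnegative
  for \<open>s = 0\<close> and at least \<open>M\<close> on the three other sides, and the second has Laplacian \<open>-N\<close>.
  As \<open>\<psi>\<close> is at most \<open>(2 M / \<rho> + \<rho> N / 2) s\<close> on the axis \<open>t = 0\<close>, dividing by \<open>s\<close> bounds the derivative.\<close>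

lemma gradient_estimate_poisson_real:
  fixes U U1 U2 U11 U22 :: "real \<Rightarrow> real \<Rightarrow> real"
  assumes "0 < \<rho>"
    and cont: "continuous_on ({-\<rho>..\<rho>} \<times> {-\<rho>..\<rho>}) (\<lambda>(s, t). U s t)"
    and U1: "\<And>s t. \<bar>s\<bar> < \<rho> \<Longrightarrow> \<bar>t\<bar> < \<rho> \<Longrightarrow> ((\<lambda>s. U s t) has_real_derivative U1 s t) (at s)"
    and U11: "\<And>s t. \<bar>s\<bar> < \<rho> \<Longrightarrow> \<bar>t\<bar> < \<rho> \<Longrightarrow> ((\<lambda>s. U1 s t) has_real_derivative U11 s t) (at s)"
    and U2: "\<And>s t. \<bar>s\<bar> < \<rho> \<Longrightarrow> \<bar>t\<bar> < \<rho> \<Longrightarrow> ((\<lambda>t. U s t) has_real_derivative U2 s t) (at t)"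
    and U22: "\<And>s t. \<bar>s\<bar> < \<rho> \<Longrightarrow> \<bar>t\<bar> < \<rho> \<Longrightarrow> ((\<lambda>t. U2 s t) has_real_derivative U22 s t) (at t)"
    and M: "\<And>s t. \<bar>s\<bar> \<le> \<rho> \<Longrightarrow> \<bar>t\<bar> \<le> \<rho> \<Longrightarrow> \<bar>U s t\<bar> \<le> M"
    and N: "\<And>s t. \<bar>s\<bar> < \<rho> \<Longrightarrow> \<bar>t\<bar> < \<rho> \<Longrightarrow> \<bar>U11 s t + U22 s t\<bar> \<le> N"
  shows "U1 0 0 \<le> 2 * M / \<rho> + \<rho> / 2 * N"
proof (rule field_le_epsilon)
  fix \<epsilon> :: real assume "0 < \<epsilon>"
  \<comment> \<open>the minimum principle needs a strict inequality, so N is enlarged by as much as changes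
    the final bound by exactly \<epsilon>\<close>
  define N' where "N' = N + 2 * \<epsilon> / \<rho>"
  define L where "L = M / \<rho>\<^sup>2"
  have M0: "0 \<le> M" using M[of 0 0] assms(1) by force
  have N0: "0 \<le> N" using N[of 0 0] assms(1) by force
  have N': "N < N'" using \<open>0 < \<epsilon>\<close> assms(1) by (simp add: N'_def)
  have L: "0 \<le> L" "L * \<rho>\<^sup>2 = M" using M0 assms(1) by (auto simp: L_def)
  \<comment> \<open>V is the barrier minus the odd part of U\<close>
  define V where "V s t = L * (t\<^sup>2 + s * (2 * \<rho> - s)) + N' / 2 * (s * (\<rho> - s)) - (U s t - U (-s) t) / 2"
    for s t
  define V1 where "V1 s t = L * (2 * \<rho> - 2 * s) + N' / 2 * (\<rho> - 2 * s) - (U1 s t + U1 (-s) t) / 2"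
    for s t
  define V11 where "V11 s t = - 2 * L - N' - (U11 s t - U11 (-s) t) / 2" for s t
  define V2 where "V2 s t = 2 * L * t - (U2 s t - U2 (-s) t) / 2" for s t
  define V22 where "V22 s t = 2 * L - (U22 s t - U22 (-s) t) / 2" for s t
  have mirror: "((\<lambda>s. f (-s)) has_real_derivative - D) (at s)"
    if "(f has_real_derivative D) (at (-s))" for f D s
    using DERIV_mirror[of f "-D" s] that by (simp add: DERIV_mirror)
  have V_nonneg: "0 \<le> V s t" if "s \<in> {0..\<rho>}" "t \<in> {-\<rho>..\<rho>}" for s t
  proof (rule superharmonic_nonneg[where a = 0 and b = \<rho> and c = "-\<rho>" and d = \<rho> and ?V1.0 = V1 and ?V2.0 = V2
        and ?V11.0 = V11 and ?V22.0 = V22, OF _ _ _ _ _ _ _ that])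
    have "continuous_on ({0..\<rho>} \<times> {-\<rho>..\<rho>}) (\<lambda>p. (\<lambda>(s, t). U s t) (- fst p, snd p))"
      by (rule continuous_on_compose2[OF cont]) (auto intro!: continuous_intros)
    moreover have "continuous_on ({0..\<rho>} \<times> {-\<rho>..\<rho>}) (\<lambda>(s, t). U s t)"
      by (rule continuous_on_subset[OF cont]) auto
    ultimately show "continuous_on ({0..\<rho>} \<times> {-\<rho>..\<rho>}) (\<lambda>(s, t). V s t)"
      unfolding V_def case_prod_beta by (intro continuous_intros) auto
  next
    fix s t assume st: "0 < s" "s < \<rho>" "-\<rho> < t" "t < \<rho>"
    show "((\<lambda>s. V s t) has_real_derivative V1 s t) (at s)"
      unfolding V_def V1_def
      by (rule derivative_eq_intros mirror[of "\<lambda>s. U s t"] U1 refl | use st in force)+ (simp add: algebra_simps)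
    show "((\<lambda>s. V1 s t) has_real_derivative V11 s t) (at s)"
      unfolding V1_def V11_def
      by (rule derivative_eq_intros mirror[of "\<lambda>s. U1 s t"] U11 refl | use st in force)+
    show "((\<lambda>t. V s t) has_real_derivative V2 s t) (at t)"
      unfolding V_def V2_def
      by (rule derivative_eq_intros U2 refl | use st in force)+ 
    show "((\<lambda>t. V2 s t) has_real_derivative V22 s t) (at t)"
      unfolding V2_def V22_def
      by (rule derivative_eq_intros U22 refl | use st in force)+ 
    show "V11 s t + V22 s t < 0"
    proof -
      have "\<bar>U11 s t + U22 s t\<bar> \<le> N" "\<bar>U11 (-s) t + U22 (-s) t\<bar> \<le> N"
        by (rule N; use st in force)+
      moreover have "V11 s t + V22 s t = - N' - ((U11 s t + U22 s t) - (U11 (-s) t + U22 (-s) t)) / 2"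
        by (simp add: V11_def V22_def field_simps)
      ultimately show ?thesis using N' unfolding abs_le_iff by argo
    qed
  next
    fix s t assume st: "s \<in> {0..\<rho>}" "t \<in> {-\<rho>..\<rho>}" "s = 0 \<or> s = \<rho> \<or> t = -\<rho> \<or> t = \<rho>"
    have U: "\<bar>U s t\<bar> \<le> M" "\<bar>U (-s) t\<bar> \<le> M" using M st by auto
    have nn: "0 \<le> N' / 2 * (s * (\<rho> - s))" "0 \<le> s * (2 * \<rho> - s)"
      using N0 N' st assms(1) by auto
    show "0 \<le> V s t"
    proof (cases "s = 0")
      case True
      then show ?thesis using L by (simp add: V_def)
    next
      case False
      then have "\<rho>\<^sup>2 \<le> t\<^sup>2 + s * (2 * \<rho> - s)"
        using st(3) nn(2) by (auto simp: power2_eq_square algebra_simps)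
      then have "M \<le> L * (t\<^sup>2 + s * (2 * \<rho> - s))"
        using L by (metis mult_left_mono)
      moreover have "(U s t - U (-s) t) / 2 \<le> M" using U by (simp add: abs_le_iff)
      ultimately show ?thesis using nn(1) unfolding V_def by argo
    qed
  qed
  define K where "K = 2 * \<rho> * L + \<rho> / 2 * N'"
  have K: "K = 2 * M / \<rho> + \<rho> / 2 * N + \<epsilon>"
    using assms(1) by (simp add: K_def L_def N'_def power2_eq_square field_simps)
  define h where "h s = (U s 0 - U (-s) 0) / 2 - K * s" for s
  have "(h has_real_derivative (U1 0 0 - K)) (at 0)"
    unfolding h_def
    by (rule derivative_eq_intros mirror[of "\<lambda>s. U s 0"] U1 refl | use assms(1) in force)+
  moreover have "h s \<le> h 0" if "0 < s" "s < \<rho>" for s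
  proof -
    have "(U s 0 - U (-s) 0) / 2 \<le> L * (s * (2 * \<rho> - s)) + N' / 2 * (s * (\<rho> - s))"
      using V_nonneg[of s 0] that by (simp add: V_def)
    also have "\<dots> = K * s - (L + N' / 2) * s\<^sup>2"
      by (simp add: K_def algebra_simps power2_eq_square)
    also have "\<dots> \<le> K * s" using L N0 N' by simp
    finally show ?thesis by (simp add: h_def)
  qed
  ultimately have "U1 0 0 \<le> K"
  proof -
    have False if pos: "0 < U1 0 0 - K"
    proof -
      obtain d where d: "0 < d" "\<And>s. 0 < s \<Longrightarrow> s < d \<Longrightarrow> h 0 < h (0 + s)"
        using DERIV_pos_inc_right[OF \<open>(h has_real_derivative _) _\<close> pos] by auto
      define s where "s = min d \<rho> / 2"
      have "0 < s" "s < d" "s < \<rho>" using d assms(1) by (auto simp: s_def)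
      then show False using d(2)[of s] \<open>\<And>s. 0 < s \<Longrightarrow> s < \<rho> \<Longrightarrow> h s \<le> h 0\<close>[of s] by simp
    qed
    then show ?thesis by force
  qed
  then show "U1 0 0 \<le> 2 * M / \<rho> + \<rho> / 2 * N + \<epsilon>" by (simp add: K)
qed

section \<open>The Maass operators, the Laplacian and the slash action\<close>

text \<open>The sign \<open>\<sigma> = \<plusminus>1\<close> selects the raising or the lowering operator, so that both are treated at once; the
  weight of the image is \<open>k + 2 \<sigma>\<close>.\<close>

definition maass_op :: "complex \<Rightarrow> complex \<Rightarrow> (complex \<Rightarrow> complex) \<Rightarrow> complex \<Rightarrow> complex"
  where "maass_op \<sigma> k u z =
    \<sigma> * (2 * \<i> * of_real (Im z) * dx u z) + 2 * of_real (Im z) * dy u z + \<sigma> * k * u z"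

lemma E_plus_eq_maass_op: "E_plus k = maass_op 1 k"
  and E_minus_eq_maass_op: "E_minus k = maass_op (-1) k"
  by (simp_all add: fun_eq_iff maass_op_def E_plus_def E_minus_def)

text \<open>Slashed functions only need to be as smooth as the second-order calculus requires, and this
  class is more convenient than real-analyticity under composition with Moebius maps.\<close>

definition twice_differentiable_on :: "(complex \<Rightarrow> complex) \<Rightarrow> complex set \<Rightarrow> bool"
  where "twice_differentiable_on u S \<longleftrightarrow> (\<forall>z\<in>S. u differentiable (at z) \<and>
    dx u differentiable (at z) \<and> dy u differentiable (at z))"

lemma real_analytic_on_imp_twice_differentiable_on:
  "real_analytic_on u S \<Longrightarrow> twice_differentiable_on u S"
  unfolding twice_differentiable_on_def
  using real_analytic_on_imp_differentiable real_analytic_on_dx real_analytic_on_dy by blast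

lemma real_analytic_on_maass_op:
  assumes "real_analytic_on u S"
  shows "real_analytic_on (maass_op \<sigma> k u) S"
proof -
  have "maass_op \<sigma> k u = (\<lambda>z. \<sigma> * 2 * \<i> * (of_real (Im z) * dx u z) + 2 * (of_real (Im z) * dy u z)
      + (\<sigma> * k) * u z)"
    by (simp add: maass_op_def fun_eq_iff)
  then show ?thesis
    by (simp only:) (intro real_analytic_on_add real_analytic_on_cmult real_analytic_on_mult_Im
      real_analytic_on_dx real_analytic_on_dy assms)
qed

lemma differentiable_has_derivative:
  assumes "f differentiable (at z)"
  shows "(f has_derivative (\<lambda>h. of_real (Re h) * dx f z + of_real (Im h) * dy f z)) (at z)"
proof -
  obtain D where D: "(f has_derivative D) (at z)"
    using assms by (auto simp: differentiable_def)
  interpret D: bounded_linear D using D by (rule has_derivative_bounded_linear)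
  have "D h = of_real (Re h) * dx f z + of_real (Im h) * dy f z" for h
  proof -
    have "D h = D (Re h *\<^sub>R 1 + Im h *\<^sub>R \<i>)"
      by (rule arg_cong[where f = D]) (simp add: complex_eq_iff)
    then show ?thesis
      using has_derivative_imp_dx_dy[OF D] unfolding D.add D.scaleR by (simp add: scaleR_conv_of_real)
  qed
  then show ?thesis using D by presburger
qed

lemma dx_dy_cong_open:
  assumes "open S" "z \<in> S" "\<And>w. w \<in> S \<Longrightarrow> f w = g w"
  shows "dx f z = dx g z" "dy f z = dy g z"
proof -
  have "((\<lambda>s. Complex s (Im z)) \<longlongrightarrow> Complex (Re z) (Im z)) (nhds (Re z))"
    by (intro tendsto_intros filterlim_ident)
  then have "eventually (\<lambda>s. Complex s (Im z) \<in> S) (nhds (Re z))"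
    using assms(1,2) by (simp add: topological_tendstoD)
  then have "eventually (\<lambda>s. s \<in> UNIV \<longrightarrow> f (Complex s (Im z)) = g (Complex s (Im z))) (nhds (Re z))"
    by eventually_elim (simp add: assms(3))
  then show "dx f z = dx g z"
    unfolding dx_def by (intro vector_derivative_cong_eq) auto
  have "((\<lambda>t. Complex (Re z) t) \<longlongrightarrow> Complex (Re z) (Im z)) (nhds (Im z))"
    by (intro tendsto_intros filterlim_ident)
  then have "eventually (\<lambda>t. Complex (Re z) t \<in> S) (nhds (Im z))"
    using assms(1,2) by (simp add: topological_tendstoD)
  then have "eventually (\<lambda>t. t \<in> UNIV \<longrightarrow> f (Complex (Re z) t) = g (Complex (Re z) t)) (nhds (Im z))"
    by eventually_elim (simp add: assms(3))
  then show "dy f z = dy g z"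
    unfolding dy_def by (intro vector_derivative_cong_eq) auto
qed

lemma maass_op_cong_open:
  assumes "open S" "z \<in> S" "\<And>w. w \<in> S \<Longrightarrow> f w = g w"
  shows "maass_op \<sigma> k f z = maass_op \<sigma> k g z"
  by (simp add: maass_op_def dx_dy_cong_open[OF assms] assms)

lemma maass_op_has_derivative:
  assumes "u differentiable (at z)" "dx u differentiable (at z)" "dy u differentiable (at z)"
  shows "(maass_op \<sigma> k u has_derivative (\<lambda>h.
      \<sigma> * 2 * \<i> * (of_real (Im z) * (of_real (Re h) * dx (dx u) z + of_real (Im h) * dy (dx u) z)
        + of_real (Im h) * dx u z)
    + 2 * (of_real (Im z) * (of_real (Re h) * dx (dy u) z + of_real (Im h) * dy (dy u) z)
        + of_real (Im h) * dy u z)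
    + \<sigma> * k * (of_real (Re h) * dx u z + of_real (Im h) * dy u z))) (at z)"
proof -
  note d = assms[THEN differentiable_has_derivative]
  show ?thesis
    unfolding maass_op_def
    by (rule has_derivative_eq_rhs, (rule derivative_intros d)+) (simp add: fun_eq_iff algebra_simps)
qed

lemma
  assumes "u differentiable (at z)" "dx u differentiable (at z)" "dy u differentiable (at z)"
  shows dx_maass_op: "dx (maass_op \<sigma> k u) z =
      \<sigma> * 2 * \<i> * of_real (Im z) * dx (dx u) z + 2 * of_real (Im z) * dx (dy u) z + \<sigma> * k * dx u z"
    and dy_maass_op: "dy (maass_op \<sigma> k u) z =
      \<sigma> * 2 * \<i> * (of_real (Im z) * dy (dx u) z + dx u z) + 2 * (of_real (Im z) * dy (dy u) z + dy u z)
      + \<sigma> * k * dy u z"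
  using has_derivative_imp_dx_dy[OF maass_op_has_derivative[OF assms]] by (simp_all add: algebra_simps)

text \<open>The mixed derivatives arise with opposite signs from the two terms
  \<open>\<sigma> 2 i y \<partial>\<^sub>x\<close> and \<open>2 y \<partial>\<^sub>y\<close>. They are kept in the formula so that it can be used before
  their equality is known.\<close>

lemma maass_op_maass_op:
  assumes "u differentiable (at z)" "dx u differentiable (at z)" "dy u differentiable (at z)"
    and \<sigma>: "\<sigma>\<^sup>2 = 1"
  shows "maass_op (-\<sigma>) (k + 2 * \<sigma>) (maass_op \<sigma> k u) z =
    - 4 * laplace k u z - k * (k + 2 * \<sigma>) * u z
    + 4 * \<sigma> * \<i> * of_real ((Im z)\<^sup>2) * (dy (dx u) z - dx (dy u) z)"
proof -
  have \<sigma>3: "\<sigma> * \<sigma> = 1" "\<sigma> * (\<sigma> * x) = x" for x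
    using \<sigma> by (simp_all add: power2_eq_square flip: mult.assoc)
  have i: "\<i> * (\<i> * x) = - x" for x by (simp flip: mult.assoc)
  show ?thesis
    unfolding maass_op_def[of "-\<sigma>"] dx_maass_op[OF assms(1-3)] dy_maass_op[OF assms(1-3)]
      laplace_def maass_op_def[of \<sigma>]
    by (simp add: algebra_simps power2_eq_square \<sigma>3 i)
qed

text \<open>The sum of the two compositions is free of mixed derivatives. It therefore expresses the
  Laplacian through the first-order operators without an appeal to their symmetry, which makes it
  the right tool for functions of the form \<open>u|\<^sub>k \<gamma>\<close>.\<close>

lemma laplace_eq_maass_ops:
  assumes "u differentiable (at z)" "dx u differentiable (at z)" "dy u differentiable (at z)"
  shows "- 8 * laplace k u z = maass_op (-1) (k + 2) (maass_op 1 k u) z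
    + maass_op 1 (k - 2) (maass_op (-1) k u) z + 2 * k\<^sup>2 * u z"
proof -
  let ?m = "4 * \<i> * of_real ((Im z)\<^sup>2) * (dy (dx u) z - dx (dy u) z)"
  have 1: "maass_op (-1) (k + 2) (maass_op 1 k u) z = - 4 * laplace k u z - k * (k + 2) * u z + ?m"
    using maass_op_maass_op[OF assms, of 1 k] by simp
  have 2: "maass_op 1 (k - 2) (maass_op (-1) k u) z = - 4 * laplace k u z - k * (k - 2) * u z - ?m"
    using maass_op_maass_op[OF assms, of "-1" k] by simp
  show ?thesis unfolding 1 2 by (simp add: algebra_simps power2_eq_square)
qed

text \<open>Transformation laws hold on \<open>\<H>\<close> and not on all of \<open>\<complex>\<close>, hence the open set.\<close>

lemma maass_op_linear:
  assumes "open S" "z \<in> S" "\<And>w. w \<in> S \<Longrightarrow> f w = c * u w" "u differentiable (at z)"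
  shows "maass_op \<sigma> k f z = c * maass_op \<sigma> k u z"
proof -
  have "((\<lambda>w. c * u w) has_derivative
      (\<lambda>h. c * (of_real (Re h) * dx u z + of_real (Im h) * dy u z))) (at z)"
    by (intro has_derivative_mult_right differentiable_has_derivative assms)
  note D = has_derivative_imp_dx_dy[OF this]
  have "maass_op \<sigma> k f z = maass_op \<sigma> k (\<lambda>w. c * u w) z"
    by (rule maass_op_cong_open[OF assms(1-3)])
  then show ?thesis by (simp add: maass_op_def D algebra_simps)
qed

text \<open>Write \<open>e = E u\<close> and let \<open>E'\<close> be the opposite operator. On eigenfunctions \<open>E' e\<close> is a multiple of \<open>u\<close>, so
  \<open>E E' e\<close> is the same multiple of \<open>e\<close>; but \<open>E E' e\<close> is also \<open>-4 \<Delta> e\<close> plus a multiple of \<open>e\<close>. The constants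
  \<open>k (k + 2\<sigma>)\<close> of the two compositions agree and cancel.\<close>

lemma laplace_maass_op:
  assumes S: "open S" and u: "real_analytic_on u S" and eig: "\<And>z. z \<in> S \<Longrightarrow> laplace k u z = \<mu> * u z"
    and \<sigma>: "\<sigma>\<^sup>2 = 1" and z: "z \<in> S"
  shows "laplace (k + 2 * \<sigma>) (maass_op \<sigma> k u) z = \<mu> * maass_op \<sigma> k u z"
proof -
  define e where "e = maass_op \<sigma> k u"
  have e: "real_analytic_on e S"
    unfolding e_def by (rule real_analytic_on_maass_op[OF u])
  note diffs = real_analytic_on_imp_differentiable real_analytic_on_dx real_analytic_on_dy
  have lower: "maass_op (-\<sigma>) (k + 2 * \<sigma>) e w = (- 4 * \<mu> - k * (k + 2 * \<sigma>)) * u w" if w: "w \<in> S" for w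
    using maass_op_maass_op[of u w \<sigma> k] real_analytic_on_imp_mixed_partials_eq[OF u w] eig[OF w] \<sigma>
    by (simp add: e_def diffs(1)[OF _ w] diffs(2,3) u algebra_simps)
  have "maass_op \<sigma> k (maass_op (-\<sigma>) (k + 2 * \<sigma>) e) z = (- 4 * \<mu> - k * (k + 2 * \<sigma>)) * e z"
    unfolding e_def by (rule maass_op_linear[OF S z]) (use lower u z diffs in \<open>auto simp: e_def\<close>)
  moreover have "maass_op \<sigma> k (maass_op (-\<sigma>) (k + 2 * \<sigma>) e) z =
      - 4 * laplace (k + 2 * \<sigma>) e z - (k + 2 * \<sigma>) * k * e z"
    using maass_op_maass_op[of e z "-\<sigma>" "k + 2 * \<sigma>"] real_analytic_on_imp_mixed_partials_eq[OF e z] \<sigma>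
    by (simp add: diffs(1)[OF _ z] diffs(2,3) e)
  ultimately show ?thesis by (simp add: e_def algebra_simps)
qed

lemma open_upper_half_plane: "open \<H>"
  by (simp add: upper_half_plane_def open_halfspace_Im_gt)

definition denom :: "int^2^2 \<Rightarrow> complex \<Rightarrow> complex"
  where "denom \<gamma> z = of_int (\<gamma>$2$1) * z + of_int (\<gamma>$2$2)"

lemma denom_nonzero:
  assumes "det \<gamma> = 1" "z \<in> \<H>"
  shows "denom \<gamma> z \<noteq> 0"
proof
  assume "denom \<gamma> z = 0"
  then have "Im (denom \<gamma> z) = 0" "Re (denom \<gamma> z) = 0" by auto
  then have "\<gamma>$2$1 = 0" "\<gamma>$2$2 = 0"
    using assms(2) by (auto simp: denom_def upper_half_plane_def)
  then show False using assms(1) by (simp add: det_2)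
qed

lemma Im_moebius:
  assumes "det \<gamma> = 1" "z \<in> \<H>"
  shows "Im (moebius \<gamma> z) = Im z / (norm (denom \<gamma> z))\<^sup>2"
proof -
  have "real_of_int (\<gamma>$1$1) * of_int (\<gamma>$2$2) - of_int (\<gamma>$1$2) * of_int (\<gamma>$2$1) = 1"
    using assms(1) by (simp add: det_2 flip: of_int_mult of_int_diff)
  then have "Im z * (real_of_int (\<gamma>$1$1) * of_int (\<gamma>$2$2) - of_int (\<gamma>$1$2) * of_int (\<gamma>$2$1)) = Im z"
    by simp
  then have "Im ((of_int (\<gamma>$1$1) * z + of_int (\<gamma>$1$2)) * cnj (denom \<gamma> z)) = Im z"
    by (simp add: denom_def algebra_simps)
  then show ?thesis
    unfolding moebius_def denom_def[symmetric] by (simp add: complex_div_cnj[of _ "denom \<gamma> z"] Im_divide_of_real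
        del: times_complex.simps complex_cnj_mult flip: of_real_power)
qed

lemma moebius_in_upper_half_plane:
  "det \<gamma> = 1 \<Longrightarrow> z \<in> \<H> \<Longrightarrow> moebius \<gamma> z \<in> \<H>"
  using Im_moebius[of \<gamma> z] denom_nonzero[of \<gamma> z] by (simp add: upper_half_plane_def)

lemma moebius_has_field_derivative:
  assumes "det \<gamma> = 1" "z \<in> \<H>"
  shows "(moebius \<gamma> has_field_derivative 1 / (denom \<gamma> z)\<^sup>2) (at z)"
proof -
  have "complex_of_int (\<gamma>$1$1) * of_int (\<gamma>$2$2) - of_int (\<gamma>$1$2) * of_int (\<gamma>$2$1) = 1"
    using assms(1) by (simp add: det_2 flip: of_int_mult of_int_diff)
  then have *: "of_int (\<gamma>$1$1) * denom \<gamma> z - (of_int (\<gamma>$1$1) * z + of_int (\<gamma>$1$2)) * of_int (\<gamma>$2$1) = 1"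
    by (simp add: denom_def algebra_simps)
  show ?thesis
    unfolding moebius_def[abs_def] denom_def[symmetric]
    by (rule derivative_eq_intros refl | use denom_nonzero[OF assms] * in \<open>simp add: denom_def power2_eq_square\<close>)+
qed

text \<open>For \<open>c \<noteq> 0\<close> the values of \<open>c z + d\<close> on \<open>\<H>\<close> avoid the real axis, hence the branch cut, and the argument is
  the imaginary part of a holomorphic logarithm. For \<open>c = 0\<close> the value may lie on the cut, but the
  argument is constant, and the formula gives \<open>0\<close> as well.\<close>

lemma arg_factor_has_derivative:
  assumes "det \<gamma> = 1" "z \<in> \<H>"
  shows "(arg_factor \<gamma> has_derivative (\<lambda>h. Im (of_int (\<gamma>$2$1) * h / denom \<gamma> z))) (at z)"
proof (cases "\<gamma>$2$1 = 0")
  case True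
  then show ?thesis by (simp add: arg_factor_def[abs_def])
next
  case False
  then have "Im (denom \<gamma> z) \<noteq> 0" using assms(2) by (simp add: denom_def upper_half_plane_def)
  then have nr: "denom \<gamma> z \<notin> \<real>\<^sub>\<le>\<^sub>0" by (auto simp: complex_nonpos_Reals_iff)
  have "((\<lambda>w. Ln (denom \<gamma> w)) has_field_derivative of_int (\<gamma>$2$1) / denom \<gamma> z) (at z)"
    using nr by (auto intro!: derivative_eq_intros simp: denom_def divide_inverse)
  then have "((\<lambda>w. Im (Ln (denom \<gamma> w))) has_derivative (\<lambda>h. Im (of_int (\<gamma>$2$1) / denom \<gamma> z * h))) (at z)"
    unfolding has_field_derivative_def by (rule bounded_linear.has_derivative[OF bounded_linear_Im])
  then have "(arg_factor \<gamma> has_derivative (\<lambda>h. Im (of_int (\<gamma>$2$1) / denom \<gamma> z * h))) (at z)"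
    by (rule has_derivative_transform_within_open[OF _ open_upper_half_plane assms(2)])
      (use denom_nonzero[OF assms(1)] in \<open>simp add: arg_factor_def denom_def Arg_eq_Im_Ln\<close>)
  then show ?thesis by simp
qed

lemma exp_arg_factor:
  assumes "det \<gamma> = 1" "z \<in> \<H>"
  shows "exp (- (\<i> * 2 * of_real (arg_factor \<gamma> z))) = cnj (denom \<gamma> z) / denom \<gamma> z"
proof -
  let ?j = "denom \<gamma> z" and ?e = "exp (\<i> * of_real (arg_factor \<gamma> z))"
  have j: "?j = of_real (norm ?j) * ?e"
    using Arg_eq[OF denom_nonzero[OF assms]] by (simp add: arg_factor_def denom_def)
  have "cnj ?j = of_real (norm ?j) * exp (- (\<i> * of_real (arg_factor \<gamma> z)))"
    by (subst j) (simp add: exp_cnj)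
  then have "cnj ?j / ?j = exp (- (\<i> * of_real (arg_factor \<gamma> z))) / ?e"
    using denom_nonzero[OF assms] by (subst (2) j) simp
  also have "\<dots> = exp (- (\<i> * 2 * of_real (arg_factor \<gamma> z)))"
    by (simp add: mult_ac flip: exp_diff)
  finally show ?thesis by simp
qed

lemma slash_has_derivative:
  assumes "det \<gamma> = 1" "z \<in> \<H>" "f differentiable (at (moebius \<gamma> z))"
  shows "(slash f k \<gamma> has_derivative (\<lambda>h. exp (- (\<i> * k * of_real (arg_factor \<gamma> z))) *
      (of_real (Re (h / (denom \<gamma> z)\<^sup>2)) * dx f (moebius \<gamma> z) + of_real (Im (h / (denom \<gamma> z)\<^sup>2)) * dy f (moebius \<gamma> z)
       - \<i> * k * of_real (Im (of_int (\<gamma>$2$1) * h / denom \<gamma> z)) * f (moebius \<gamma> z)))) (at z)"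
proof -
  have m: "(moebius \<gamma> has_derivative (\<lambda>h. h / (denom \<gamma> z)\<^sup>2)) (at z)"
    using moebius_has_field_derivative[OF assms(1,2)] unfolding has_field_derivative_def
    by (rule has_derivative_eq_rhs) (simp add: fun_eq_iff)
  have fm: "((\<lambda>w. f (moebius \<gamma> w)) has_derivative (\<lambda>h. of_real (Re (h / (denom \<gamma> z)\<^sup>2)) * dx f (moebius \<gamma> z)
      + of_real (Im (h / (denom \<gamma> z)\<^sup>2)) * dy f (moebius \<gamma> z))) (at z)"
    by (rule has_derivative_compose[OF m differentiable_has_derivative[OF assms(3)]])
  have "((\<lambda>w. - (\<i> * k * of_real (arg_factor \<gamma> w))) has_derivative
      (\<lambda>h. - (\<i> * k * of_real (Im (of_int (\<gamma>$2$1) * h / denom \<gamma> z))))) (at z)"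
    by (intro derivative_intros arg_factor_has_derivative[OF assms(1,2)])
  moreover have "(exp has_derivative (\<lambda>h. exp (- (\<i> * k * of_real (arg_factor \<gamma> z))) * h))
      (at (- (\<i> * k * of_real (arg_factor \<gamma> z))))"
    using DERIV_exp by (simp add: has_field_derivative_def)
  ultimately have ex: "((\<lambda>w. exp (- (\<i> * k * of_real (arg_factor \<gamma> w)))) has_derivative
      (\<lambda>h. exp (- (\<i> * k * of_real (arg_factor \<gamma> z)))
        * - (\<i> * k * of_real (Im (of_int (\<gamma>$2$1) * h / denom \<gamma> z))))) (at z)"
    by (rule has_derivative_compose)
  show ?thesis
    unfolding slash_def[abs_def]
    by (rule has_derivative_eq_rhs[OF has_derivative_mult[OF ex fm]]) (simp add: fun_eq_iff algebra_simps)
qed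

lemma slash_differentiable:
  assumes "det \<gamma> = 1" "z \<in> \<H>" "f differentiable (at (moebius \<gamma> z))"
  shows "slash f k \<gamma> differentiable (at z)"
  using slash_has_derivative[OF assms] differentiableI by blast

text \<open>With \<open>j = c z + d\<close>, the derivative of the Moebius map is \<open>1 / j\<^sup>2\<close> and that of the argument is the
  imaginary part of \<open>c / j\<close>. Collecting the coefficients of the derivatives of \<open>f\<close> and of \<open>f\<close> itself, the
  claim reduces to two scalar identities, in which \<open>\<epsilon> = e\<^sup>-\<^sup>2\<^sup>i\<^sup>\<sigma>\<^sup>\<theta>\<close> is the quotient of the
  automorphy factors of the two weights. The identities for \<open>\<sigma> = -1\<close> are the complex conjugates
  of those for \<open>\<sigma> = 1\<close>.\<close>

lemma maass_op_slash:
  assumes "det \<gamma> = 1" "z \<in> \<H>" "f differentiable (at (moebius \<gamma> z))" and \<sigma>: "\<sigma> = 1 \<or> \<sigma> = -1"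
  shows "maass_op \<sigma> k (slash f k \<gamma>) z = slash (maass_op \<sigma> k f) (k + 2 * \<sigma>) \<gamma> z"
proof -
  define j c y where "j = denom \<gamma> z" and "c = complex_of_int (\<gamma>$2$1)" and "y = complex_of_real (Im z)"
  define \<epsilon> where "\<epsilon> = exp (- (\<i> * (2 * \<sigma>) * of_real (arg_factor \<gamma> z)))"
  define J where "J = exp (- (\<i> * k * of_real (arg_factor \<gamma> z)))"
  define fx fy f0 where "fx = dx f (moebius \<gamma> z)" and "fy = dy f (moebius \<gamma> z)" and "f0 = f (moebius \<gamma> z)"
  have j: "j \<noteq> 0" unfolding j_def by (rule denom_nonzero[OF assms(1,2)])
  have e1: "exp (- (\<i> * 2 * of_real (arg_factor \<gamma> z))) = cnj j / j"
    unfolding j_def by (rule exp_arg_factor[OF assms(1,2)])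
  have jj: "complex_of_real ((norm j)\<^sup>2) = j * cnj j"
    by (rule complex_norm_square)
  have A1: "1 / j\<^sup>2 = cnj j / j / of_real ((norm j)\<^sup>2)"
    using j unfolding jj by (simp add: power2_eq_square)
  have "j - cnj j = 2 * \<i> * (c * y)"
    by (simp add: complex_eq_iff j_def c_def y_def denom_def)
  then have B1: "1 - 2 * \<i> * y * (c / j) = cnj j / j"
    using j by (simp add: field_simps)
  have split: "complex_of_real (Re p) + \<i> * of_real (Im p) = p" "complex_of_real (Re p) - \<i> * of_real (Im p) = cnj p" for p
    by (simp_all add: complex_eq_iff)
  \<comment> \<open>A governs the derivatives of f, B the zeroth-order term\<close>
  have A: "of_real (Re (1 / j\<^sup>2)) + \<sigma> * \<i> * of_real (Im (1 / j\<^sup>2)) = \<epsilon> / of_real ((norm j)\<^sup>2)"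
    and B: "1 + 2 * y * of_real (Im (c / j)) - 2 * \<i> * \<sigma> * y * of_real (Re (c / j)) = \<epsilon>"
  proof -
    consider "\<sigma> = 1" | "\<sigma> = -1" using \<sigma> by blast
    then have "of_real (Re (1 / j\<^sup>2)) + \<sigma> * \<i> * of_real (Im (1 / j\<^sup>2)) = \<epsilon> / of_real ((norm j)\<^sup>2) \<and>
      1 + 2 * y * of_real (Im (c / j)) - 2 * \<i> * \<sigma> * y * of_real (Re (c / j)) = \<epsilon>"
    proof cases
      case 1
      have "1 + 2 * y * of_real (Im (c / j)) - 2 * \<i> * \<sigma> * y * of_real (Re (c / j)) =
          1 - 2 * \<i> * y * (of_real (Re (c / j)) + \<i> * of_real (Im (c / j)))"
        by (simp add: 1 algebra_simps)
      moreover have "\<epsilon> = cnj j / j" using e1 by (simp add: \<epsilon>_def 1)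
      moreover have "of_real (Re (1 / j\<^sup>2)) + \<sigma> * \<i> * of_real (Im (1 / j\<^sup>2)) = 1 / j\<^sup>2"
        using split(1)[of "1 / j\<^sup>2"] by (simp add: 1)
      ultimately show ?thesis by (simp only: split A1 B1)
    next
      case 2
      have "1 + 2 * y * of_real (Im (c / j)) - 2 * \<i> * \<sigma> * y * of_real (Re (c / j)) =
          cnj (1 - 2 * \<i> * y * (of_real (Re (c / j)) + \<i> * of_real (Im (c / j))))"
        by (simp add: 2 algebra_simps y_def)
      moreover have "\<epsilon> = cnj (cnj j / j)"
        using e1[symmetric] by (simp add: \<epsilon>_def 2 exp_cnj)
      moreover have "of_real (Re (1 / j\<^sup>2)) + \<sigma> * \<i> * of_real (Im (1 / j\<^sup>2)) = cnj (1 / j\<^sup>2)"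
        using split(2)[of "1 / j\<^sup>2"] by (simp add: 2)
      moreover have "cnj (1 / j\<^sup>2) = cnj (cnj j / j) / of_real ((norm j)\<^sup>2)"
        by (simp only: A1 complex_cnj_divide complex_cnj_complex_of_real)
      ultimately show ?thesis by (simp only: split B1)
    qed
    then show "of_real (Re (1 / j\<^sup>2)) + \<sigma> * \<i> * of_real (Im (1 / j\<^sup>2)) = \<epsilon> / of_real ((norm j)\<^sup>2)"
      and "1 + 2 * y * of_real (Im (c / j)) - 2 * \<i> * \<sigma> * y * of_real (Re (c / j)) = \<epsilon>"
      by blast+
  qed
  have \<sigma>2: "\<sigma> * \<sigma> = 1" "\<sigma> * (\<sigma> * x) = x" for x using \<sigma> by auto
  have ii: "\<i> * (\<i> * x) = - x" for x by (simp flip: mult.assoc)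
  note D = has_derivative_imp_dx_dy[OF slash_has_derivative[OF assms(1-3)], folded j_def c_def J_def fx_def fy_def f0_def]
  have rot: "Re (\<i> / j\<^sup>2) = - Im (1 / j\<^sup>2)" "Im (\<i> / j\<^sup>2) = Re (1 / j\<^sup>2)"
    "Im (c * \<i> / j) = Re (c / j)" "Im (c * 1 / j) = Im (c / j)"
    using times_divide_eq_right[of \<i> 1 "j\<^sup>2"] times_divide_eq_right[of \<i> c j] 
    by (metis Re_i_times Im_i_times mult.right_neutral mult.commute)+
  have sl: "slash f k \<gamma> z = J * f0" by (simp add: slash_def J_def f0_def)
  have "maass_op \<sigma> k (slash f k \<gamma>) z = J *
     (2 * y * (\<sigma> * \<i> * fx + fy) * (of_real (Re (1 / j\<^sup>2)) + \<sigma> * \<i> * of_real (Im (1 / j\<^sup>2)))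
      + \<sigma> * k * f0 * (1 + 2 * y * of_real (Im (c / j)) - 2 * \<i> * \<sigma> * y * of_real (Re (c / j))))"
    unfolding maass_op_def D rot sl y_def[symmetric]
    by (simp add: J_def algebra_simps \<sigma>2 ii)
  also have "\<dots> = J * \<epsilon> * (2 * (y / of_real ((norm j)\<^sup>2)) * (\<sigma> * \<i> * fx + fy) + \<sigma> * k * f0)"
    unfolding A B by (simp add: algebra_simps add_divide_distrib)
  also have "y / of_real ((norm j)\<^sup>2) = of_real (Im (moebius \<gamma> z))"
    unfolding Im_moebius[OF assms(1,2)] y_def j_def by simp
  also have "J * \<epsilon> = exp (- (\<i> * (k + 2 * \<sigma>) * of_real (arg_factor \<gamma> z)))"
    unfolding J_def \<epsilon>_def by (simp add: algebra_simps flip: exp_add)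
  also have "exp (- (\<i> * (k + 2 * \<sigma>) * of_real (arg_factor \<gamma> z))) *
      (2 * of_real (Im (moebius \<gamma> z)) * (\<sigma> * \<i> * fx + fy) + \<sigma> * k * f0) =
      slash (maass_op \<sigma> k f) (k + 2 * \<sigma>) \<gamma> z"
    unfolding slash_def maass_op_def fx_def fy_def f0_def by (simp add: algebra_simps)
  finally show ?thesis .
qed

section \<open>Interior estimates for perturbed Poisson equations\<close>

text \<open>Closed squares are used instead of discs because the barrier argument lives on rectangles. The
  radius is half the side length; the case \<open>r = 1\<close> is called the unit square below.\<close>

definition square :: "complex \<Rightarrow> real \<Rightarrow> complex set"
  where "square z r = {w. \<bar>Re w - Re z\<bar> \<le> r \<and> \<bar>Im w - Im z\<bar> \<le> r}"

lemma partial_derivatives_Re_mult: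
  assumes "f differentiable (at (z + Complex s t))"
  shows "((\<lambda>s. Re (c * f (z + Complex s t))) has_real_derivative Re (c * dx f (z + Complex s t))) (at s)"
    and "((\<lambda>t. Re (c * f (z + Complex s t))) has_real_derivative Re (c * dy f (z + Complex s t))) (at t)"
proof -
  note D = differentiable_has_derivative[OF assms]
  have 1: "((\<lambda>s. z + Complex s t) has_derivative (\<lambda>h. of_real h)) (at s)"
    unfolding Complex_eq by (auto intro!: derivative_eq_intros)
  have 2: "((\<lambda>t. z + Complex s t) has_derivative (\<lambda>h. \<i> * of_real h)) (at t)"
    unfolding Complex_eq by (auto intro!: derivative_eq_intros)
  have bl: "bounded_linear (\<lambda>w. Re (c * w))"
    by (intro bounded_linear_compose[OF bounded_linear_Re] bounded_linear_mult_right)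
  show "((\<lambda>s. Re (c * f (z + Complex s t))) has_real_derivative Re (c * dx f (z + Complex s t))) (at s)"
    using bounded_linear.has_derivative[OF bl has_derivative_compose[OF 1 D]]
    unfolding has_field_derivative_def
    by (rule has_derivative_eq_rhs) (simp add: fun_eq_iff algebra_simps)
  show "((\<lambda>t. Re (c * f (z + Complex s t))) has_real_derivative Re (c * dy f (z + Complex s t))) (at t)"
    using bounded_linear.has_derivative[OF bl has_derivative_compose[OF 2 D]]
    unfolding has_field_derivative_def
    by (rule has_derivative_eq_rhs) (simp add: fun_eq_iff algebra_simps)
qed

text \<open>The real estimate is applied to the real part of \<open>c w\<close>, where \<open>c\<close> rotates the derivative in
  question onto the positive real axis.\<close>

lemma gradient_estimate_poisson:
  assumes "0 < \<rho>" and sub: "square z \<rho> \<subseteq> S" and w: "twice_differentiable_on w S"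
    and M: "\<And>\<zeta>. \<zeta> \<in> square z \<rho> \<Longrightarrow> norm (w \<zeta>) \<le> M"
    and N: "\<And>\<zeta>. \<zeta> \<in> square z \<rho> \<Longrightarrow> norm (dx (dx w) \<zeta> + dy (dy w) \<zeta>) \<le> N"
  shows "norm (dx w z) \<le> 2 * M / \<rho> + \<rho> / 2 * N" "norm (dy w z) \<le> 2 * M / \<rho> + \<rho> / 2 * N"
proof -
  have inK: "z + Complex s t \<in> square z \<rho>" if "\<bar>s\<bar> \<le> \<rho>" "\<bar>t\<bar> \<le> \<rho>" for s t
    using that by (simp add: square_def)
  have diff: "w differentiable (at (z + Complex s t))" "dx w differentiable (at (z + Complex s t))"
    "dy w differentiable (at (z + Complex s t))" if "\<bar>s\<bar> < \<rho>" "\<bar>t\<bar> < \<rho>" for s t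
    using inK[of s t] sub w that by (auto simp: twice_differentiable_on_def)
  have "continuous_on (square z \<rho>) w"
    using w sub by (intro continuous_at_imp_continuous_on)
      (auto simp: twice_differentiable_on_def intro!: differentiable_imp_continuous_within)
  then have cont: "continuous_on ({-\<rho>..\<rho>} \<times> {-\<rho>..\<rho>}) (\<lambda>p. w (z + Complex (fst p) (snd p)))"
      "continuous_on ({-\<rho>..\<rho>} \<times> {-\<rho>..\<rho>}) (\<lambda>p. w (z + Complex (snd p) (fst p)))"
    by (rule continuous_on_compose2; force intro!: continuous_intros inK)+
  have bound: "\<bar>Re (c * \<zeta>)\<bar> \<le> B" if "norm c \<le> 1" "norm \<zeta> \<le> B" for c \<zeta> B
  proof -
    have "\<bar>Re (c * \<zeta>)\<bar> \<le> norm c * norm \<zeta>" using abs_Re_le_cmod[of "c * \<zeta>"] by (simp add: norm_mult)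
    also have "\<dots> \<le> norm \<zeta>" using that(1) by (simp add: mult_left_le_one_le)
    finally show ?thesis using that(2) by linarith
  qed
  have cnj_sgn: "Re (cnj (sgn d) * d) = norm d" "norm (cnj (sgn d)) \<le> 1" for d :: complex
  proof -
    have "cnj d * d = of_real ((norm d)\<^sup>2)"
      by (simp only: complex_norm_square mult.commute)
    then have "cnj (sgn d) * d = of_real (norm d)"
      by (cases "d = 0") (simp_all add: sgn_eq power2_eq_square)
    then show "Re (cnj (sgn d) * d) = norm d" by simp
    show "norm (cnj (sgn d)) \<le> 1" by (simp add: norm_sgn)
  qed
  have U: "\<bar>Re (c * w (z + Complex s t))\<bar> \<le> M"
    if "norm c \<le> 1" "\<bar>s\<bar> \<le> \<rho>" "\<bar>t\<bar> \<le> \<rho>" for c s t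
    by (rule bound[OF that(1) M[OF inK[OF that(2,3)]]])
  have L: "\<bar>Re (c * dx (dx w) (z + Complex s t)) + Re (c * dy (dy w) (z + Complex s t))\<bar> \<le> N"
    if "norm c \<le> 1" "\<bar>s\<bar> < \<rho>" "\<bar>t\<bar> < \<rho>" for c s t
  proof -
    have "\<bar>Re (c * (dx (dx w) (z + Complex s t) + dy (dy w) (z + Complex s t)))\<bar> \<le> N"
      by (rule bound[OF that(1) N[OF inK]]) (use that in auto)
    then show ?thesis by (simp only: distrib_left plus_complex.sel)
  qed
  note P = partial_derivatives_Re_mult
  have X: "Re (c * dx w (z + Complex 0 0)) \<le> 2 * M / \<rho> + \<rho> / 2 * N"
    and Y: "Re (c * dy w (z + Complex 0 0)) \<le> 2 * M / \<rho> + \<rho> / 2 * N" if c: "norm c \<le> 1" for c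
  proof -
    have "continuous_on ({-\<rho>..\<rho>} \<times> {-\<rho>..\<rho>}) (\<lambda>(s, t). Re (c * w (z + Complex s t)))"
      unfolding case_prod_unfold by (intro continuous_intros cont)
    from gradient_estimate_poisson_real[where ?U1.0 = "\<lambda>s t. Re (c * dx w (z + Complex s t))",
        OF \<open>0 < \<rho>\<close> this P(1)[OF diff(1)] P(1)[OF diff(2)] P(2)[OF diff(1)] P(2)[OF diff(3)] U[OF c] L[OF c]]
    show "Re (c * dx w (z + Complex 0 0)) \<le> 2 * M / \<rho> + \<rho> / 2 * N" .
    have "continuous_on ({-\<rho>..\<rho>} \<times> {-\<rho>..\<rho>}) (\<lambda>(t, s). Re (c * w (z + Complex s t)))"
      unfolding case_prod_unfold by (intro continuous_intros cont)
    from gradient_estimate_poisson_real[where ?U1.0 = "\<lambda>t s. Re (c * dy w (z + Complex s t))",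
        OF \<open>0 < \<rho>\<close> this P(2)[OF diff(1)] P(2)[OF diff(3)] P(1)[OF diff(1)] P(1)[OF diff(2)] U[OF c]
        L[OF c, unfolded add.commute[of "Re (c * dx (dx w) _)"]]]
    show "Re (c * dy w (z + Complex 0 0)) \<le> 2 * M / \<rho> + \<rho> / 2 * N" by blast
  qed
  have "z + Complex 0 0 = z" by (simp add: complex_eq_iff)
  then show "norm (dx w z) \<le> 2 * M / \<rho> + \<rho> / 2 * N" "norm (dy w z) \<le> 2 * M / \<rho> + \<rho> / 2 * N"
    using X[OF cnj_sgn(2)[of "dx w z"]] Y[OF cnj_sgn(2)[of "dy w z"]] by (simp_all only: cnj_sgn(1))
qed

text \<open>The right-hand side of the differential inequality contains the derivative that is to be bounded. The
  weight \<open>d\<close>, the distance to the boundary of the unit square, makes absorption possible: let \<open>A\<close> be the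
  maximum of \<open>d |w\<^sub>x|\<close>. On the square of radius \<open>d(\<xi>) / 2\<close> around \<open>\<xi>\<close> one has \<open>|w\<^sub>x| \<le> 2 A / d(\<xi>)\<close>, and the
  estimate for the Poisson equation there gives \<open>A \<le> 4 M + A / 2 + M / 4\<close> at a point where \<open>A\<close> is attained. Hence
  \<open>A \<le> 17 M / 2\<close>, and a second application of the estimate at the centre bounds both derivatives.\<close>

lemma interior_gradient_estimate:
  assumes sub: "square z 1 \<subseteq> S" and w: "twice_differentiable_on w S"
    and M: "\<And>\<zeta>. \<zeta> \<in> square z 1 \<Longrightarrow> norm (w \<zeta>) \<le> M"
    and pde: "\<And>\<zeta>. \<zeta> \<in> square z 1 \<Longrightarrow>
      norm (dx (dx w) \<zeta> + dy (dy w) \<zeta>) \<le> norm (dx w \<zeta>) + norm (w \<zeta>)"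
  shows "norm (dx w z) \<le> 9 * M" "norm (dy w z) \<le> 9 * M"
proof -
  define d where "d \<zeta> = 1 - max \<bar>Re \<zeta> - Re z\<bar> \<bar>Im \<zeta> - Im z\<bar>" for \<zeta>
  have zK: "z \<in> square z 1" by (simp add: square_def)
  have M0: "0 \<le> M" using M[OF zK] norm_ge_zero order_trans by blast
  have "square z 1 = cbox (z - (1 + \<i>)) (z + (1 + \<i>))"
    by (auto simp: square_def in_cbox_complex_iff abs_le_iff)
  then have "compact (square z 1)" by (metis compact_cbox)
  moreover have "continuous_on (square z 1) (\<lambda>\<zeta>. d \<zeta> * norm (dx w \<zeta>))"
  proof -
    have "continuous_on (square z 1) (dx w)"
      using w sub by (intro continuous_at_imp_continuous_on)
        (auto simp: twice_differentiable_on_def intro!: differentiable_imp_continuous_within)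
    then show ?thesis unfolding d_def by (intro continuous_intros)
  qed
  ultimately obtain z1 where z1: "z1 \<in> square z 1"
    and max: "\<And>\<zeta>. \<zeta> \<in> square z 1 \<Longrightarrow> d \<zeta> * norm (dx w \<zeta>) \<le> d z1 * norm (dx w z1)"
    using continuous_attains_sup[of "square z 1"] zK by blast
  define A where "A = d z1 * norm (dx w z1)"
  have dz: "d z = 1" by (simp add: d_def)
  have d01: "0 \<le> d \<zeta>" "d \<zeta> \<le> 1" if "\<zeta> \<in> square z 1" for \<zeta>
    using that by (auto simp: d_def square_def)
  have A0: "0 \<le> A" using d01[OF z1] by (simp add: A_def)
  have local: "norm (dx w \<xi>) \<le> 4 * M / d \<xi> + d \<xi> / 4 * (2 * A / d \<xi> + M)"
      "norm (dy w \<xi>) \<le> 4 * M / d \<xi> + d \<xi> / 4 * (2 * A / d \<xi> + M)"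
    if \<xi>: "\<xi> \<in> square z 1" "0 < d \<xi>" for \<xi>
  proof -
    define \<rho> where "\<rho> = d \<xi> / 2"
    have \<rho>: "0 < \<rho>" using \<xi> by (simp add: \<rho>_def)
    have near: "\<zeta> \<in> square z 1 \<and> \<rho> \<le> d \<zeta>" if "\<zeta> \<in> square \<xi> \<rho>" for \<zeta>
    proof -
      have "max \<bar>Re \<xi> - Re z\<bar> \<bar>Im \<xi> - Im z\<bar> = 1 - 2 * \<rho>"
        by (simp add: \<rho>_def d_def add_divide_distrib diff_divide_distrib)
      then have "\<bar>Re \<xi> - Re z\<bar> \<le> 1 - 2 * \<rho>" "\<bar>Im \<xi> - Im z\<bar> \<le> 1 - 2 * \<rho>" by linarith+
      moreover have "\<bar>Re \<zeta> - Re \<xi>\<bar> \<le> \<rho>" "\<bar>Im \<zeta> - Im \<xi>\<bar> \<le> \<rho>" using that by (auto simp: square_def)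
      ultimately have "\<bar>Re \<zeta> - Re z\<bar> \<le> 1 - \<rho>" "\<bar>Im \<zeta> - Im z\<bar> \<le> 1 - \<rho>" by linarith+
      then show ?thesis using \<rho> by (simp add: square_def d_def)
    qed
    have N: "norm (dx (dx w) \<zeta> + dy (dy w) \<zeta>) \<le> A / \<rho> + M" if \<zeta>: "\<zeta> \<in> square \<xi> \<rho>" for \<zeta>
    proof -
      have "\<rho> * norm (dx w \<zeta>) \<le> d \<zeta> * norm (dx w \<zeta>)"
        using near[OF \<zeta>] by (intro mult_right_mono) auto
      also have "\<dots> \<le> A" using max near[OF \<zeta>] by (simp add: A_def)
      finally have "norm (dx w \<zeta>) \<le> A / \<rho>" using \<rho> by (simp add: field_simps)
      then show ?thesis using pde[of \<zeta>] M[of \<zeta>] near[OF \<zeta>] by linarith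
    qed
    have "square \<xi> \<rho> \<subseteq> S" using near sub by blast
    note est = gradient_estimate_poisson[OF \<rho> this w, of M "A / \<rho> + M"]
    have eq: "2 * M / \<rho> + \<rho> / 2 * (A / \<rho> + M) = 4 * M / d \<xi> + d \<xi> / 4 * (2 * A / d \<xi> + M)"
      by (simp add: \<rho>_def)
    show "norm (dx w \<xi>) \<le> 4 * M / d \<xi> + d \<xi> / 4 * (2 * A / d \<xi> + M)"
      using est(1) N M near unfolding eq by blast
    show "norm (dy w \<xi>) \<le> 4 * M / d \<xi> + d \<xi> / 4 * (2 * A / d \<xi> + M)"
      using est(2) N M near unfolding eq by blast
  qed
  have A_le: "A \<le> 17 / 2 * M"
  proof (cases "d z1 = 0")
    case True
    then show ?thesis using M0 by (simp add: A_def)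
  next
    case False
    define \<delta> where "\<delta> = d z1"
    have \<delta>: "0 < \<delta>" "\<delta> \<le> 1" using False d01[OF z1] by (auto simp: \<delta>_def)
    have "A \<le> \<delta> * (4 * M / \<delta> + \<delta> / 4 * (2 * A / \<delta> + M))"
      unfolding A_def \<delta>_def[symmetric]
      using local(1)[OF z1] \<delta> unfolding A_def \<delta>_def[symmetric] by (intro mult_left_mono) auto
    also have "\<dots> = 4 * M + \<delta> * (A / 2) + \<delta>\<^sup>2 * (M / 4)"
      using \<delta> by (simp add: field_simps power2_eq_square)
    also have "\<dots> \<le> 4 * M + 1 * (A / 2) + 1 * (M / 4)"
      using \<delta> A0 M0 by (intro add_mono mult_right_mono power_le_one) auto
    finally show ?thesis by simp
  qed
  show "norm (dx w z) \<le> 9 * M"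
    using local(1)[OF zK] A_le M0 unfolding dz by argo
  show "norm (dy w z) \<le> 9 * M"
    using local(2)[OF zK] A_le M0 unfolding dz by argo
qed

section \<open>Slashed functions and growth at the cusps\<close>

text \<open>The partial derivatives of \<open>w = u|\<^sub>k \<gamma>\<close> are linear combinations, with smooth coefficients, of \<open>w\<close> and of \<open>E\<^sup>\<plusminus> w\<close>; the
  latter are the slashed functions \<open>E\<^sup>\<plusminus> u\<close> and hence differentiable. So second derivatives of a
  composition never have to be computed.\<close>

lemma slash_twice_differentiable_on:
  assumes \<gamma>: "det \<gamma> = 1" and u: "twice_differentiable_on u \<H>"
  shows "twice_differentiable_on (slash u k \<gamma>) \<H>"
proof -
  define w where "w = slash u k \<gamma>"
  have m: "moebius \<gamma> z \<in> \<H>" if "z \<in> \<H>" for z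
    using moebius_in_upper_half_plane[OF \<gamma> that] .
  have du: "u differentiable (at z)" "dx u differentiable (at z)" "dy u differentiable (at z)"
    if "z \<in> \<H>" for z using u that by (auto simp: twice_differentiable_on_def)
  have wd: "w differentiable (at z)" if "z \<in> \<H>" for z
    unfolding w_def by (rule slash_differentiable[OF \<gamma> that du(1)[OF m[OF that]]])
  have Ew: "maass_op \<sigma> k w z = slash (maass_op \<sigma> k u) (k + 2 * \<sigma>) \<gamma> z"
    if "z \<in> \<H>" "\<sigma> = 1 \<or> \<sigma> = -1" for z \<sigma>
    unfolding w_def by (rule maass_op_slash[OF \<gamma> that(1) du(1)[OF m] that(2)]) (rule that(1))
  have Ed: "(\<lambda>z. slash (maass_op \<sigma> k u) (k + 2 * \<sigma>) \<gamma> z) differentiable (at z)" if "z \<in> \<H>" for z \<sigma>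
    by (rule slash_differentiable[OF \<gamma> that differentiableI[OF maass_op_has_derivative]])
      (use du m that in auto)
  have Im_d: "(\<lambda>z. complex_of_real (Im z)) differentiable (at z)" for z
    by (intro bounded_linear_imp_differentiable bounded_linear_compose[OF bounded_linear_of_real] bounded_linear_Im)
  let ?P = "slash (maass_op 1 k u) (k + 2 * 1) \<gamma>" and ?Q = "slash (maass_op (-1) k u) (k + 2 * (-1)) \<gamma>"
  have dxw: "dx w z = (?P z - ?Q z - 2 * k * w z) / (4 * \<i> * of_real (Im z))"
    and dyw: "dy w z = (?P z + ?Q z) / (4 * of_real (Im z))" if z: "z \<in> \<H>" for z
  proof -
    have "complex_of_real (Im z) \<noteq> 0" using z by (simp add: upper_half_plane_def)
    moreover have "?P z - ?Q z - 2 * k * w z = dx w z * (4 * \<i> * of_real (Im z))"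
      and "?P z + ?Q z = dy w z * (4 * of_real (Im z))"
      unfolding Ew[OF z disjI1[OF refl], symmetric] Ew[OF z disjI2[OF refl], symmetric] maass_op_def
      by (simp_all add: algebra_simps)
    ultimately show "dx w z = (?P z - ?Q z - 2 * k * w z) / (4 * \<i> * of_real (Im z))"
      and "dy w z = (?P z + ?Q z) / (4 * of_real (Im z))"
      by simp_all
  qed
  have "dx w differentiable (at z)" "dy w differentiable (at z)" if z: "z \<in> \<H>" for z
  proof -
    have nz: "complex_of_real (Im z) \<noteq> 0" using z by (simp add: upper_half_plane_def)
    have "(\<lambda>z. (?P z - ?Q z - 2 * k * w z) / (4 * \<i> * of_real (Im z))) differentiable (at z)"
      using nz by (intro differentiable_divide differentiable_diff differentiable_mult differentiable_const Ed wd z Im_d) auto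
    then show "dx w differentiable (at z)"
      unfolding differentiable_def
      by (elim ex_forward has_derivative_transform_within_open[OF _ open_upper_half_plane z]) (simp add: dxw)
    have "(\<lambda>z. (?P z + ?Q z) / (4 * of_real (Im z))) differentiable (at z)"
      using nz by (intro differentiable_divide differentiable_add differentiable_mult differentiable_const Ed z Im_d) auto
    then show "dy w differentiable (at z)"
      unfolding differentiable_def
      by (elim ex_forward has_derivative_transform_within_open[OF _ open_upper_half_plane z]) (simp add: dyw)
  qed
  then show ?thesis using wd unfolding twice_differentiable_on_def w_def by blast
qed

lemma laplace_slash:
  assumes \<gamma>: "det \<gamma> = 1" and u: "twice_differentiable_on u \<H>" and z: "z \<in> \<H>"
  shows "laplace k (slash u k \<gamma>) z = slash (laplace k u) k \<gamma> z"
proof -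
  have m: "moebius \<gamma> w \<in> \<H>" if "w \<in> \<H>" for w
    using moebius_in_upper_half_plane[OF \<gamma> that] .
  have du: "u differentiable (at w)" "dx u differentiable (at w)" "dy u differentiable (at w)"
    if "w \<in> \<H>" for w using u that by (auto simp: twice_differentiable_on_def)
  have dw: "slash u k \<gamma> differentiable (at z)" "dx (slash u k \<gamma>) differentiable (at z)"
    "dy (slash u k \<gamma>) differentiable (at z)"
    using slash_twice_differentiable_on[OF \<gamma> u] z by (auto simp: twice_differentiable_on_def)
  have EE: "maass_op (-\<sigma>) (k + 2 * \<sigma>) (maass_op \<sigma> k (slash u k \<gamma>)) z =
      slash (maass_op (-\<sigma>) (k + 2 * \<sigma>) (maass_op \<sigma> k u)) k \<gamma> z" if \<sigma>: "\<sigma> = 1 \<or> \<sigma> = -1" for \<sigma>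
  proof -
    have "maass_op (-\<sigma>) (k + 2 * \<sigma>) (maass_op \<sigma> k (slash u k \<gamma>)) z =
        maass_op (-\<sigma>) (k + 2 * \<sigma>) (slash (maass_op \<sigma> k u) (k + 2 * \<sigma>) \<gamma>) z"
      by (rule maass_op_cong_open[OF open_upper_half_plane z]) (use maass_op_slash \<gamma> du m \<sigma> in blast)
    also have "\<dots> = slash (maass_op (-\<sigma>) (k + 2 * \<sigma>) (maass_op \<sigma> k u)) (k + 2 * \<sigma> + 2 * (-\<sigma>)) \<gamma> z"
      by (rule maass_op_slash[OF \<gamma> z differentiableI[OF maass_op_has_derivative]])
        (use du m z \<sigma> in auto)
    finally show ?thesis by simp
  qed
  have "- 8 * laplace k (slash u k \<gamma>) z = slash (\<lambda>w. - 8 * laplace k u w) k \<gamma> z"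
    unfolding laplace_eq_maass_ops[OF dw] slash_def[of "\<lambda>w. - 8 * laplace k u w"]
      laplace_eq_maass_ops[OF du, OF m[OF z] m[OF z] m[OF z]]
    using EE[of 1] EE[of "-1"] by (simp add: slash_def algebra_simps)
  also have "\<dots> = - 8 * slash (laplace k u) k \<gamma> z" by (simp add: slash_def)
  finally show ?thesis by simp
qed

lemma norm_slash: "norm (slash f k \<gamma> z) = exp (Im k * arg_factor \<gamma> z) * norm (f (moebius \<gamma> z))"
  by (simp add: slash_def norm_mult)

lemma abs_mult_arg_factor_le: "\<bar>y * arg_factor \<gamma> z\<bar> \<le> \<bar>y\<bar> * pi"
proof -
  have "\<bar>arg_factor \<gamma> z\<bar> \<le> pi"
    using Arg_bounded[of "of_int (\<gamma>$2$1) * z + of_int (\<gamma>$2$2)"] by (auto simp: arg_factor_def abs_le_iff)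
  then show ?thesis by (simp add: abs_mult mult_left_mono)
qed

lemma eventually_vertical_strip:
  "eventually P (inf (filtercomap Im at_top) (principal {z. a \<le> Re z \<and> Re z \<le> b})) \<longleftrightarrow>
    (\<exists>Y. \<forall>z. Y \<le> Im z \<longrightarrow> a \<le> Re z \<longrightarrow> Re z \<le> b \<longrightarrow> P z)"
proof -
  have "eventually P (inf (filtercomap Im at_top) (principal {z. a \<le> Re z \<and> Re z \<le> b})) \<longleftrightarrow>
      (\<exists>Y. \<forall>z. Y \<le> Im z \<longrightarrow> z \<in> {z. a \<le> Re z \<and> Re z \<le> b} \<longrightarrow> P z)"
    unfolding eventually_inf_principal eventually_filtercomap_at_top_linorder ..
  also have "\<dots> \<longleftrightarrow> (\<exists>Y. \<forall>z. Y \<le> Im z \<longrightarrow> a \<le> Re z \<longrightarrow> Re z \<le> b \<longrightarrow> P z)"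
    by (simp only: mem_Collect_eq conj_imp_eq_imp_imp imp_conjL)
  finally show ?thesis .
qed

lemma exp_growth_iff:
  "exp_growth u g \<longleftrightarrow> (\<exists>c. \<forall>a b. \<exists>C Y. \<forall>z. Y \<le> Im z \<longrightarrow> a \<le> Re z \<longrightarrow> Re z \<le> b \<longrightarrow>
    norm (u (moebius g z)) \<le> C * exp (c * Im z))"
proof -
  have "f \<in> O[F](h) \<longleftrightarrow> (\<exists>C. eventually (\<lambda>z. norm (f z) \<le> C * norm (h z)) F)"
    for f h :: "complex \<Rightarrow> complex" and F
    by (blast intro: bigoI elim: landau_o.bigE)
  then show ?thesis
    unfolding exp_growth_def by (simp add: eventually_vertical_strip[simplified])
qed

text \<open>The hypothesis on the strip \<open>[a - 1, b + 1]\<close> controls \<open>w = u|\<^sub>k g\<close> on the unit squares centred in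
  \<open>[a, b]\<close>. The exponent grows by one to absorb the factor \<open>y\<close> of the Maass operator; it has to be, and is,
  independent of \<open>a\<close> and \<open>b\<close>.\<close>

lemma exp_growth_maass_op:
  assumes g: "det g = 1" and u: "twice_differentiable_on u \<H>"
    and eig: "\<And>z. z \<in> \<H> \<Longrightarrow> laplace k u z = \<mu> * u z"
    and \<sigma>: "\<sigma> = 1 \<or> \<sigma> = -1" and growth: "exp_growth u g"
  shows "exp_growth (maass_op \<sigma> k u) g"
proof -
  obtain c where c: "\<And>a b. \<exists>C Y. \<forall>z. Y \<le> Im z \<longrightarrow> a \<le> Re z \<longrightarrow> Re z \<le> b \<longrightarrow>
      norm (u (moebius g z)) \<le> C * exp (c * Im z)"
    using growth unfolding exp_growth_iff by blast
  define w where "w = slash u k g"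
  have w: "twice_differentiable_on w \<H>"
    unfolding w_def by (rule slash_twice_differentiable_on[OF g u])
  have weig: "laplace k w z = \<mu> * w z" if "z \<in> \<H>" for z
    using laplace_slash[OF g u that] eig[OF moebius_in_upper_half_plane[OF g that]]
    by (simp add: w_def slash_def)
  show ?thesis
    unfolding exp_growth_iff
  proof (rule exI[of _ "c + 1"], intro allI)
    fix a b
    obtain C Y where CY: "\<And>z. Y \<le> Im z \<Longrightarrow> a - 1 \<le> Re z \<Longrightarrow> Re z \<le> b + 1 \<Longrightarrow>
        norm (u (moebius g z)) \<le> C * exp (c * Im z)"
      using c[of "a - 1" "b + 1"] by blast
    \<comment> \<open>B covers the automorphy factor of weight k and the variation of e^(c y) over a unit square;
      B' adds the coefficients of the operator and the automorphy factor of the new weight\<close>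
    define B where "B = exp (\<bar>Im k\<bar> * pi) * \<bar>C\<bar> * exp \<bar>c\<bar>"
    define B' where "B' = exp (\<bar>Im (k + 2 * \<sigma>)\<bar> * pi) * ((36 + norm k) * B)"
    have B0: "0 \<le> B" by (simp add: B_def)
    have "norm (maass_op \<sigma> k u (moebius g z)) \<le> B' * exp ((c + 1) * Im z)"
      if z: "max Y 1 + norm k + norm \<mu> + 1 \<le> Im z" "a \<le> Re z" "Re z \<le> b" for z
    proof -
      define M where "M = B * exp (c * Im z)"
      have M0: "0 \<le> M" using B0 by (simp add: M_def)
      \<comment> \<open>so high up, the unit square around z lies where the growth hypothesis applies and where
        the coefficients k / y and \<mu> / y^2 of the equation are at most 1\<close>
      have near: "Y \<le> Im \<zeta>" "1 \<le> Im \<zeta>" "norm k \<le> Im \<zeta>" "norm \<mu> \<le> Im \<zeta>" "a - 1 \<le> Re \<zeta>" "Re \<zeta> \<le> b + 1" "\<bar>Im \<zeta> - Im z\<bar> \<le> 1"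
        if "\<zeta> \<in> square z 1" for \<zeta>
      proof -
        have "\<bar>Re \<zeta> - Re z\<bar> \<le> 1" "\<bar>Im \<zeta> - Im z\<bar> \<le> 1" using that by (auto simp: square_def)
        moreover have "0 \<le> norm k" "0 \<le> norm \<mu>" "Y \<le> max Y 1" "1 \<le> max Y 1" by auto
        ultimately show "Y \<le> Im \<zeta>" "1 \<le> Im \<zeta>" "norm k \<le> Im \<zeta>" "norm \<mu> \<le> Im \<zeta>"
          "a - 1 \<le> Re \<zeta>" "Re \<zeta> \<le> b + 1" "\<bar>Im \<zeta> - Im z\<bar> \<le> 1"
          using z by linarith+
      qed
      have sub: "square z 1 \<subseteq> \<H>" using near(2) by (force simp: upper_half_plane_def)
      have zK: "z \<in> square z 1" by (simp add: square_def)
      have wM: "norm (w \<zeta>) \<le> M" if \<zeta>: "\<zeta> \<in> square z 1" for \<zeta>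
      proof -
        have "norm (w \<zeta>) \<le> exp (\<bar>Im k\<bar> * pi) * (\<bar>C\<bar> * exp (c * Im \<zeta>))"
          unfolding w_def norm_slash
        proof (intro mult_mono)
          show "exp (Im k * arg_factor g \<zeta>) \<le> exp (\<bar>Im k\<bar> * pi)"
            using abs_mult_arg_factor_le[of "Im k" g \<zeta>] by (simp add: abs_le_iff)
          have "C * exp (c * Im \<zeta>) \<le> \<bar>C\<bar> * exp (c * Im \<zeta>)" by (intro mult_right_mono) auto
          then show "norm (u (moebius g \<zeta>)) \<le> \<bar>C\<bar> * exp (c * Im \<zeta>)"
            using CY[of \<zeta>] near[OF \<zeta>] by linarith
        qed auto
        also have "exp (c * Im \<zeta>) \<le> exp \<bar>c\<bar> * exp (c * Im z)"
        proof -
          have "c * (Im \<zeta> - Im z) \<le> \<bar>c\<bar> * \<bar>Im \<zeta> - Im z\<bar>" by (simp flip: abs_mult)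
          also have "\<dots> \<le> \<bar>c\<bar>" using near(7)[OF \<zeta>] by (simp add: mult_left_le)
          finally show ?thesis by (simp add: algebra_simps flip: exp_add)
        qed
        finally show ?thesis by (simp add: M_def B_def mult_left_mono mult.assoc)
      qed
      have pde: "norm (dx (dx w) \<zeta> + dy (dy w) \<zeta>) \<le> norm (dx w \<zeta>) + norm (w \<zeta>)" if \<zeta>: "\<zeta> \<in> square z 1" for \<zeta>
      proof -
        define y where "y = Im \<zeta>"
        have y: "1 \<le> y" "norm k \<le> y" "norm \<mu> \<le> y" using near[OF \<zeta>] by (auto simp: y_def)
        have "of_real (y\<^sup>2) * (dx (dx w) \<zeta> + dy (dy w) \<zeta>) = \<i> * k * of_real y * dx w \<zeta> - \<mu> * w \<zeta>"
          using weig[of \<zeta>] \<zeta> sub by (auto simp: laplace_def y_def algebra_simps)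
        then have "norm (of_real (y\<^sup>2) * (dx (dx w) \<zeta> + dy (dy w) \<zeta>)) \<le>
            norm (\<i> * k * of_real y * dx w \<zeta>) + norm (\<mu> * w \<zeta>)"
          by (simp only: norm_triangle_ineq4)
        then have "y\<^sup>2 * norm (dx (dx w) \<zeta> + dy (dy w) \<zeta>) \<le> norm k * y * norm (dx w \<zeta>) + norm \<mu> * norm (w \<zeta>)"
          using y by (simp add: norm_mult norm_power)
        also have "\<dots> \<le> y\<^sup>2 * norm (dx w \<zeta>) + y\<^sup>2 * norm (w \<zeta>)"
        proof (intro add_mono mult_right_mono)
          show "norm k * y \<le> y\<^sup>2" using y by (simp add: power2_eq_square)
          show "norm \<mu> \<le> y\<^sup>2" using y self_le_power[of y 2] by simp
        qed auto
        finally have "y\<^sup>2 * norm (dx (dx w) \<zeta> + dy (dy w) \<zeta>) \<le> y\<^sup>2 * (norm (dx w \<zeta>) + norm (w \<zeta>))"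
          by (simp add: algebra_simps)
        then show ?thesis using y by simp
      qed
      note grad = interior_gradient_estimate[OF sub w wM pde]
      have y: "1 \<le> Im z" using near(2)[OF zK] .
      have "norm (maass_op \<sigma> k w z) \<le> norm (\<sigma> * (2 * \<i> * of_real (Im z) * dx w z))
          + norm (2 * of_real (Im z) * dy w z) + norm (\<sigma> * k * w z)"
        unfolding maass_op_def by (intro order_trans[OF norm_triangle_ineq] add_right_mono norm_triangle_ineq)
      also have "\<dots> = 2 * Im z * norm (dx w z) + 2 * Im z * norm (dy w z) + norm k * norm (w z)"
        using \<sigma> y by (auto simp: norm_mult)
      also have "\<dots> \<le> 2 * Im z * (9 * M) + 2 * Im z * (9 * M) + norm k * (Im z * M)"
      proof (intro add_mono mult_left_mono grad)
        have "M \<le> Im z * M" using mult_right_mono[OF y M0] by simp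
        then show "norm (w z) \<le> Im z * M" using wM[OF zK] by linarith
      qed (use y in auto)
      also have "\<dots> = (36 + norm k) * M * Im z" by (simp add: algebra_simps)
      also have "\<dots> \<le> (36 + norm k) * M * exp (Im z)"
      proof (rule mult_left_mono)
        show "Im z \<le> exp (Im z)" using exp_ge_add_one_self[of "Im z"] by linarith
      qed (use M0 in auto)
      also have "\<dots> = (36 + norm k) * B * exp ((c + 1) * Im z)"
        by (simp add: M_def algebra_simps exp_add)
      finally have E: "norm (maass_op \<sigma> k w z) \<le> (36 + norm k) * B * exp ((c + 1) * Im z)" .
      have zH: "z \<in> \<H>" using zK sub by blast
      have "maass_op \<sigma> k w z = slash (maass_op \<sigma> k u) (k + 2 * \<sigma>) g z"
        unfolding w_def by (rule maass_op_slash[OF g zH _ \<sigma>])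
          (use u moebius_in_upper_half_plane[OF g zH] in \<open>auto simp: twice_differentiable_on_def\<close>)
      then have "norm (maass_op \<sigma> k w z) =
          exp (Im (k + 2 * \<sigma>) * arg_factor g z) * norm (maass_op \<sigma> k u (moebius g z))"
        by (simp only: norm_slash)
      then have "norm (maass_op \<sigma> k u (moebius g z)) =
          exp (- (Im (k + 2 * \<sigma>) * arg_factor g z)) * norm (maass_op \<sigma> k w z)"
        by (simp add: exp_minus)
      also have "\<dots> \<le> exp (\<bar>Im (k + 2 * \<sigma>)\<bar> * pi) * ((36 + norm k) * B * exp ((c + 1) * Im z))"
        using abs_mult_arg_factor_le[of "Im (k + 2 * \<sigma>)" g z] by (intro mult_mono E) (auto simp: abs_le_iff)
      finally show ?thesis by (simp add: B'_def mult_ac)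
    qed
    then show "\<exists>C Y. \<forall>z. Y \<le> Im z \<longrightarrow> a \<le> Re z \<longrightarrow> Re z \<le> b \<longrightarrow>
        norm (maass_op \<sigma> k u (moebius g z)) \<le> C * exp ((c + 1) * Im z)"
      by blast
  qed
qed

lemma maass_op_gM:
  assumes det: "\<And>\<gamma>. \<gamma> \<in> \<Gamma> \<Longrightarrow> det \<gamma> = 1" "\<And>q. q \<in> C \<Longrightarrow> det (g q) = 1"
    and \<sigma>: "\<sigma> = 1 \<or> \<sigma> = -1" and u: "u \<in> gM \<Gamma> C g k v \<mu>"
  shows "maass_op \<sigma> k u \<in> gM \<Gamma> C g (k + 2 * \<sigma>) v \<mu>"
proof -
  have an: "real_analytic_on u \<H>"
    and sl: "\<And>\<gamma> z. \<gamma> \<in> \<Gamma> \<Longrightarrow> z \<in> \<H> \<Longrightarrow> slash u k \<gamma> z = v \<gamma> * u z"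
    and eig: "\<And>z. z \<in> \<H> \<Longrightarrow> laplace k u z = \<mu> * u z"
    and gr: "\<And>q. q \<in> C \<Longrightarrow> exp_growth u (g q)"
    using u by (auto simp: gM_def)
  note d = real_analytic_on_imp_differentiable[OF an]
  have \<sigma>2: "\<sigma>\<^sup>2 = 1" using \<sigma> by auto
  have "slash (maass_op \<sigma> k u) (k + 2 * \<sigma>) \<gamma> z = v \<gamma> * maass_op \<sigma> k u z"
    if \<gamma>: "\<gamma> \<in> \<Gamma>" and z: "z \<in> \<H>" for \<gamma> z
  proof -
    have "slash (maass_op \<sigma> k u) (k + 2 * \<sigma>) \<gamma> z = maass_op \<sigma> k (slash u k \<gamma>) z"
      using maass_op_slash[OF det(1)[OF \<gamma>] z d[OF moebius_in_upper_half_plane[OF det(1)[OF \<gamma>] z]] \<sigma>] by simp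
    also have "\<dots> = v \<gamma> * maass_op \<sigma> k u z"
      by (rule maass_op_linear[OF open_upper_half_plane z sl[OF \<gamma>] d[OF z]])
    finally show ?thesis .
  qed
  moreover have "exp_growth (maass_op \<sigma> k u) (g q)" if "q \<in> C" for q
    by (rule exp_growth_maass_op[OF det(2)[OF that]
          real_analytic_on_imp_twice_differentiable_on[OF an] eig \<sigma> gr[OF that]])
  ultimately show ?thesis
    using real_analytic_on_maass_op[OF an] laplace_maass_op[OF open_upper_half_plane an eig \<sigma>2]
    by (auto simp: gM_def)
qed

theorem lemma2p7:
  fixes \<Gamma> :: "(int^2^2) set"
    and k \<mu> :: complex
    and v :: "int^2^2 \<Rightarrow> complex"
    and C :: "cusp set"
    and g :: "cusp \<Rightarrow> int^2^2"
  assumes "subgroup \<Gamma> SL2Z"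
    and "finite (rcosets\<^bsub>SL2Z\<^esub> \<Gamma>)"
    and "multiplier_system \<Gamma> k v"
    and "cusp_representatives \<Gamma> C"
    and "\<And>q. q \<in> C \<Longrightarrow> scaling_matrix \<Gamma> q (g q)"
  shows "E_plus k \<in> gM \<Gamma> C g k v \<mu> \<rightarrow> gM \<Gamma> C g (k + 2) v \<mu> \<and>
         E_minus k \<in> gM \<Gamma> C g k v \<mu> \<rightarrow> gM \<Gamma> C g (k - 2) v \<mu>"
proof -
  have "det \<gamma> = 1" if "\<gamma> \<in> \<Gamma>" for \<gamma>
    using subgroup.subset[OF assms(1)] that by (auto simp: SL2Z_def)
  moreover have "det (g q) = 1" if "q \<in> C" for q
    using assms(5)[OF that] by (auto simp: scaling_matrix_def SL2Z_def)
  ultimately have "maass_op \<sigma> k u \<in> gM \<Gamma> C g (k + 2 * \<sigma>) v \<mu>"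
    if "\<sigma> = 1 \<or> \<sigma> = -1" "u \<in> gM \<Gamma> C g k v \<mu>" for \<sigma> u
    using maass_op_gM that by blast
  from this[of 1] this[of "-1"] show ?thesis
    by (simp add: E_plus_eq_maass_op E_minus_eq_maass_op)
qed

end
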